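(* The Lipschitz experts problem on a metric space $(X,\mathcal{D})$ is either $f(t)$-tractable for some $f\in o(t)$, even in the bandit setting, or it is not $g(t)$-tractable for any $g\in o(t)$, even with full feedback. The former occurs if and only if the metric completion of $X$ is a compact metric space.
   Context: Lipschitz experts problem on a metric space $(X,\mathcal{D})$ (diameter at most 1, known to the algorithm): an instance is an unknown Borel probability measure $\mathbb{P}$ on $[0,1]^X$ (product topology) such that $\mu(x)=\mathbb{E}_{f\sim\mathbb{P}}[f(x)]$ satisfies $|\mu(x)-\mu(y)|\le\mathcal{D}(x,y)$. In each round $t$ the algorithm picks $x_t$, $f_t\sim\mathbb{P}$ is drawn independently, and the algorithm receives $f_t(x_t)$. Bandit setting: only $f_t(x_t)$ is observed. Full feedback: the algorithm may also query $f_t$ at any finite number of points. Regret $R(t)=t\sup_x\mu(x)-\mathbb{E}[\sum_{s\le t}\mu(x_s)]$. $f(t)$-tractable: there is an algorithm such that for every instance there is a constant $C$ with $R(t)\le Cf(t)$ for all $t$. $f\in o(t)$ means $f(t)/t\to0$. *)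

theory Defs
  imports "HOL-Probability.Probability"
begin

text \<open>
  The metric space \<open>(X, D)\<close> is the type \<open>'a :: metric_space\<close> with its \<open>dist\<close>, so \<open>[0,1]^X\<close> is a
  closed subset of \<open>'a \<Rightarrow> real\<close>, whose library topology is the product topology.
\<close>

definition mean :: "('a \<Rightarrow> real) measure \<Rightarrow> 'a \<Rightarrow> real" where
  "mean P x = (\<integral>f. f x \<partial>P)"

definition expert_instance :: "('a::metric_space \<Rightarrow> real) measure \<Rightarrow> bool" where
  "expert_instance P \<longleftrightarrow>
     prob_space P \<and>
     sets P = sets (restrict_space borel {f. \<forall>x. f x \<in> {0..1}}) \<and>
     (\<forall>x y. \<bar>mean P x - mean P y\<bar> \<le> dist x y)"

text \<open>
  Rounds are numbered from 0. Evaluation \<open>(t, k)\<close> is the \<open>k\<close>-th evaluation of \<open>f\<^sub>t\<close>: evaluation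
  \<open>(t, 0)\<close> is the point played in round \<open>t\<close>, and for \<open>k \<ge> 1\<close> evaluation \<open>(t, k)\<close> is a further query,
  made only if \<open>ask\<close> says so. Every decision may depend on the internal randomness (a sample from
  \<open>seed\<close>) and on the values seen at all lexicographically earlier evaluations. A query that is not
  made is recorded with the value 0; this conveys nothing, because whether it is made is already
  determined by the seed and the earlier values.
\<close>

record ('s, 'a) algorithm =
  seed :: "'s measure"
  point :: "nat \<times> nat \<Rightarrow> 's \<times> (nat \<times> nat \<Rightarrow> real) \<Rightarrow> 'a"
  ask :: "nat \<times> nat \<Rightarrow> 's \<times> (nat \<times> nat \<Rightarrow> real) \<Rightarrow> bool"

definition before :: "nat \<times> nat \<Rightarrow> (nat \<times> nat) set" where
  "before p = {q. fst q < fst p \<or> fst q = fst p \<and> snd q < snd p}"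

lemma restrict_fundef_cong [fundef_cong]:
  "A = B \<Longrightarrow> (\<And>x. x \<in> B \<Longrightarrow> f x = g x) \<Longrightarrow> restrict f A = restrict g B"
  by (auto simp: restrict_def)

function observed ::
  "('s, 'a) algorithm \<Rightarrow> 's \<Rightarrow> (nat \<Rightarrow> 'a \<Rightarrow> real) \<Rightarrow> nat \<times> nat \<Rightarrow> real" where
  "observed A s F p =
     (let info = (s, restrict (\<lambda>q. observed A s F q) (before p))
      in if snd p = 0 \<or> ask A p info then F (fst p) (point A p info) else 0)"
  by pat_completeness auto
termination
  by (relation "inv_image (less_than <*lex*> less_than) (\<lambda>(A, s, F, p). p)")
    (auto simp: before_def)

declare observed.simps [simp del]

definition info ::
  "('s, 'a) algorithm \<Rightarrow> 's \<Rightarrow> (nat \<Rightarrow> 'a \<Rightarrow> real) \<Rightarrow> nat \<times> nat \<Rightarrow> 's \<times> (nat \<times> nat \<Rightarrow> real)" where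
  "info A s F p = (s, restrict (observed A s F) (before p))"

definition played :: "('s, 'a) algorithm \<Rightarrow> nat \<Rightarrow> 's \<times> (nat \<Rightarrow> 'a \<Rightarrow> real) \<Rightarrow> 'a" where
  "played A t \<omega> = point A (t, 0) (info A (fst \<omega>) (snd \<omega>) (t, 0))"

definition info_space :: "('s, 'a) algorithm \<Rightarrow> nat \<times> nat \<Rightarrow> ('s \<times> (nat \<times> nat \<Rightarrow> real)) measure" where
  "info_space A p = seed A \<Otimes>\<^sub>M (\<Pi>\<^sub>M q\<in>before p. borel)"

definition full_feedback_algorithm :: "('s, 'a::metric_space) algorithm \<Rightarrow> bool" where
  "full_feedback_algorithm A \<longleftrightarrow>
     prob_space (seed A) \<and>
     (\<forall>p. point A p \<in> measurable (info_space A p) borel) \<and>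
     (\<forall>p. ask A p \<in> measurable (info_space A p) (count_space UNIV)) \<and>
     (\<forall>s\<in>space (seed A). \<forall>F. (\<forall>t x. F t x \<in> {0..1}) \<longrightarrow>
        (\<forall>t. finite {k. k \<ge> 1 \<and> ask A (t, k) (info A s F (t, k))}))"

definition bandit_algorithm :: "('s, 'a::metric_space) algorithm \<Rightarrow> bool" where
  "bandit_algorithm A \<longleftrightarrow>
     full_feedback_algorithm A \<and> (\<forall>t k i. k \<ge> 1 \<longrightarrow> \<not> ask A (t, k) i)"

definition run_space ::
  "('s, 'a) algorithm \<Rightarrow> ('a \<Rightarrow> real) measure \<Rightarrow> ('s \<times> (nat \<Rightarrow> 'a \<Rightarrow> real)) measure" where
  "run_space A P = seed A \<Otimes>\<^sub>M (\<Pi>\<^sub>M t\<in>UNIV. P)"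

definition regret :: "('s, 'a) algorithm \<Rightarrow> ('a \<Rightarrow> real) measure \<Rightarrow> nat \<Rightarrow> real" where
  "regret A P t =
     real t * (SUP x. mean P x) - (\<integral>\<omega>. (\<Sum>i<t. mean P (played A i \<omega>)) \<partial>run_space A P)"

text \<open>
  For uncountable \<open>X\<close> the evaluation map \<open>(f, x) \<mapsto> f x\<close> need not be jointly measurable, so
  measurability of the decision rules does not by itself make the expected reward meaningful on
  every instance; the first conjunct says that it is.
\<close>

definition achieves :: "('s, 'a::metric_space) algorithm \<Rightarrow> (nat \<Rightarrow> real) \<Rightarrow> bool" where
  "achieves A f \<longleftrightarrow>
     (\<forall>P. expert_instance P \<longrightarrow>
        (\<forall>t. (\<lambda>\<omega>. mean P (played A t \<omega>)) \<in> borel_measurable (run_space A P)) \<and>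
        (\<exists>C. \<forall>t\<ge>1. regret A P t \<le> C * f t))"

text \<open>The first type argument is the metric space, the second the type of the random seeds.\<close>

definition bandit_tractable :: "'a::metric_space itself \<Rightarrow> 's itself \<Rightarrow> (nat \<Rightarrow> real) \<Rightarrow> bool" where
  "bandit_tractable _ _ f \<longleftrightarrow>
     (\<exists>A :: ('s, 'a) algorithm. bandit_algorithm A \<and> achieves A f)"

definition full_feedback_tractable ::
  "'a::metric_space itself \<Rightarrow> 's itself \<Rightarrow> (nat \<Rightarrow> real) \<Rightarrow> bool" where
  "full_feedback_tractable _ _ f \<longleftrightarrow>
     (\<exists>A :: ('s, 'a) algorithm. full_feedback_algorithm A \<and> achieves A f)"

definition sublinear :: "(nat \<Rightarrow> real) \<Rightarrow> bool" where
  "sublinear f \<longleftrightarrow> (\<lambda>t. f t / real t) \<longlonglongrightarrow> 0"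

definition metric_completion_of :: "'c metric \<Rightarrow> ('a::metric_space \<Rightarrow> 'c) \<Rightarrow> bool" where
  "metric_completion_of m j \<longleftrightarrow>
     mcomplete_of m \<and> range j \<subseteq> mspace m \<and>
     (\<forall>x y. mdist m (j x) (j y) = dist x y) \<and>
     mtopology_of m closure_of range j = mspace m"

text \<open>
  Completions are unique up to isometry, and one always exists on a subset of \<open>'a \<Rightarrow> real\<close>
  (the Kuratowski embedding).
\<close>

lemma metric_completion_of_exists:
  "\<exists>(m :: ('a \<Rightarrow> real) metric) (j :: 'a::metric_space \<Rightarrow> 'a \<Rightarrow> real). metric_completion_of m j"
proof -
  obtain j :: "'a \<Rightarrow> 'a \<Rightarrow> real" and m where "mcomplete_of m" "j \<in> UNIV \<rightarrow> mspace m"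
    "mtopology_of m closure_of j ` UNIV = mspace m"
    "\<And>x y. \<lbrakk>x \<in> UNIV; y \<in> UNIV\<rbrakk> \<Longrightarrow> mdist m (j x) (j y) = dist x y"
    using Met_TC.metric_completion by metis
  then show ?thesis
    unfolding metric_completion_of_def by blast
qed

definition compact_completion :: "'a::metric_space itself \<Rightarrow> bool" where
  "compact_completion _ \<longleftrightarrow>
     (\<exists>(m :: ('a \<Rightarrow> real) metric) (j :: 'a \<Rightarrow> 'a \<Rightarrow> real).
        metric_completion_of m j \<and> compact_space (mtopology_of m))"

end

theory Submission
  imports Defs "HOL-Library.Discrete_Functions"
begin

text \<open>
  The completion is compact iff \<open>X\<close> has finite nets at every scale.

  If it has, fix a dense sequence of arms. Sample these arms, each infinitely often, in the rounds
  whose number is a square; in all other rounds play the arm with the best sample average among an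
  initial segment of the sequence that grows slowly enough for its averages to be accurate. The
  expected loss of the latter rounds tends to 0 uniformly in the instance, and squares have
  density 0.

  If it has not, there are points \<open>x i\<close> at mutual distance \<open>\<ge> 2 h\<close>, and deterministic payoff functions
  \<open>u\<close> already defeat every algorithm. A run facing \<open>u\<close> evaluates it at finitely many points before
  round \<open>T\<close>, so with high probability it misses all balls around \<open>x i\<close> with \<open>i\<close> large. Choose rounds
  \<open>T n\<close> with \<open>\<bar>g (T n)\<bar> \<le> 4\<^sup>-\<^sup>n T n\<close> and add bumps of height \<open>h (1 - 2\<^sup>-\<^sup>n)\<close>, one after another, in balls
  that the algorithm does not notice before round \<open>T n\<close>. The regret of the limit function at time
  \<open>T n\<close> is of order \<open>2\<^sup>-\<^sup>n T n\<close>, which no multiple of \<open>g\<close> dominates.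
\<close>

section \<open>Compactness of the completion and finite nets\<close>

text \<open>A metric space is compact iff it is complete and totally bounded. The completion is
  complete by definition, and total boundedness passes between \<open>range j\<close> and its
  closure. Centres of nets of \<open>range j\<close> lie in \<open>range j\<close>, so they pull
  back along the isometry \<open>j\<close>.\<close>

lemma compact_completion_iff_finite_nets:
  "compact_completion TYPE('a::metric_space) \<longleftrightarrow>
     (\<forall>e>0. \<exists>K::'a set. finite K \<and> (\<forall>x. \<exists>k\<in>K. dist k x < e))"
proof
  assume "compact_completion TYPE('a)"
  then obtain m :: "('a \<Rightarrow> real) metric" and j :: "'a \<Rightarrow> 'a \<Rightarrow> real"
    where mj: "metric_completion_of m j" and c: "compact_space (mtopology_of m)"
    unfolding compact_completion_def by blast
  interpret Metric_space "mspace m" "mdist m" by simp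
  have j: "range j \<subseteq> mspace m" "\<And>x y. mdist m (j x) (j y) = dist x y"
    using mj by (auto simp: metric_completion_of_def)
  have "mtotally_bounded (mspace m)"
    using c by (simp add: mtopology_of_def compact_space_eq_mcomplete_mtotally_bounded)
  then have tb: "mtotally_bounded (range j)"
    using j(1) mtotally_bounded_subset by blast
  show "\<forall>e>0. \<exists>K::'a set. finite K \<and> (\<forall>x. \<exists>k\<in>K. dist k x < e)"
  proof (intro allI impI)
    fix e :: real assume "e > 0"
    then obtain K where K: "finite K" "K \<subseteq> range j" "range j \<subseteq> (\<Union>x\<in>K. mball x e)"
      using tb unfolding mtotally_bounded_def by meson
    obtain K' where K': "finite K'" "K = j ` K'"
      using K finite_subset_image by (metis (no_types, lifting))
    have "\<exists>k\<in>K'. dist k x < e" for x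
    proof -
      have "j x \<in> (\<Union>k\<in>K'. mball (j k) e)"
        using K(3) K'(2) by blast
      then show ?thesis
        by (auto simp: j(2))
    qed
    then show "\<exists>K::'a set. finite K \<and> (\<forall>x. \<exists>k\<in>K. dist k x < e)"
      using K'(1) by blast
  qed
next
  assume nets: "\<forall>e>0. \<exists>K::'a set. finite K \<and> (\<forall>x. \<exists>k\<in>K. dist k x < e)"
  obtain m :: "('a \<Rightarrow> real) metric" and j :: "'a \<Rightarrow> 'a \<Rightarrow> real"
    where mj: "metric_completion_of m j"
    using metric_completion_of_exists by blast
  interpret Metric_space "mspace m" "mdist m" by simp
  have j: "range j \<subseteq> mspace m" "\<And>x y. mdist m (j x) (j y) = dist x y"
    "mcomplete_of m" "mtopology_of m closure_of range j = mspace m"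
    using mj by (auto simp: metric_completion_of_def)
  have "mtotally_bounded (range j)"
    unfolding mtotally_bounded_def
  proof (intro allI impI)
    fix e :: real assume "e > 0"
    then obtain K :: "'a set" where K: "finite K" "\<And>x. \<exists>k\<in>K. dist k x < e"
      using nets by meson
    have "range j \<subseteq> (\<Union>x\<in>j ` K. mball x e)"
    proof clarify
      fix x
      obtain k where "k \<in> K" "dist k x < e"
        using K(2) by blast
      then show "j x \<in> (\<Union>x\<in>j ` K. mball x e)"
        using j(1) by (auto simp: j(2) intro!: bexI[of _ k])
    qed
    then show "\<exists>K. finite K \<and> K \<subseteq> range j \<and> range j \<subseteq> (\<Union>x\<in>K. mball x e)"
      using K(1) by (intro exI[of _ "j ` K"]) auto
  qed
  then have "mtotally_bounded (mspace m)"
    using mtotally_bounded_closure_of[of "range j"] j(4) by (simp add: mtopology_of_def)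
  then have "compact_space (mtopology_of m)"
    using j(3) by (simp add: mtopology_of_def mcomplete_of_def
        compact_space_eq_mcomplete_mtotally_bounded)
  then show "compact_completion TYPE('a)"
    using mj unfolding compact_completion_def by blast
qed

text \<open>Greedy choice: finitely many points never form a net, so some point keeps distance
  \<open>e\<close> from all of them. The state of the dependent choice is the list of all points
  chosen so far, since each new point is compared with every earlier one.\<close>

lemma separated_sequence_if_no_finite_net:
  fixes e :: real
  assumes "\<nexists>K::'a::metric_space set. finite K \<and> (\<forall>x. \<exists>k\<in>K. dist k x < e)"
  shows "\<exists>x :: nat \<Rightarrow> 'a. \<forall>i j. i \<noteq> j \<longrightarrow> e \<le> dist (x i) (x j)"
proof -
  have step: "\<exists>y. \<forall>k\<in>K. e \<le> dist k y" if "finite K" for K :: "'a set"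
    using assms that by (meson not_le)
  have "\<exists>f :: nat \<Rightarrow> 'a list. \<forall>n. length (f n) = n \<and> (\<exists>y. f (Suc n) = f n @ [y] \<and>
     (\<forall>k\<in>set (f n). e \<le> dist k y))"
  proof (rule dependent_nat_choice)
    fix xs :: "'a list" and n assume "length xs = n"
    moreover obtain y where "\<forall>k\<in>set xs. e \<le> dist k y"
      using step[of "set xs"] by blast
    ultimately show "\<exists>ys. length ys = Suc n \<and> (\<exists>y. ys = xs @ [y] \<and> (\<forall>k\<in>set xs. e \<le> dist k y))"
      by (intro exI[of _ "xs @ [y]"]) auto
  qed simp
  then obtain f :: "nat \<Rightarrow> 'a list" where f: "\<And>n. length (f n) = n"
    "\<And>n. \<exists>y. f (Suc n) = f n @ [y] \<and> (\<forall>k\<in>set (f n). e \<le> dist k y)"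
    by blast
  obtain x where x: "\<And>n. f (Suc n) = f n @ [x n]" "\<And>n k. k \<in> set (f n) \<Longrightarrow> e \<le> dist k (x n)"
    using f(2) by metis
  have mem: "x i \<in> set (f n)" if "i < n" for i n
    using that by (induction n) (auto simp: x(1) less_Suc_eq)
  have "e \<le> dist (x i) (x j)" if "i < j" for i j
    using x(2) mem that by blast
  then have "e \<le> dist (x i) (x j)" if "i \<noteq> j" for i j
    using that by (metis dist_commute nat_neq_iff)
  then show ?thesis by blast
qed

section \<open>Product measures and elementary facts on instances\<close>

text \<open>Each coordinate equals \<open>u\<close> almost surely. There are countably many
  coordinates, so almost surely all of them do at once.\<close>

lemma PiM_return_const:
  assumes "{u} \<in> sets M"
  shows "(\<Pi>\<^sub>M t\<in>(UNIV::nat set). return M u) = return (\<Pi>\<^sub>M t\<in>(UNIV::nat set). M) (\<lambda>_. u)"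
proof -
  have u: "u \<in> space M"
    using assms sets.sets_into_space by blast
  interpret prob_space "\<Pi>\<^sub>M t\<in>(UNIV::nat set). return M u"
    by (intro prob_space_PiM prob_space_return u)
  have "AE x in (\<Pi>\<^sub>M t\<in>(UNIV::nat set). return M u). x t = u" for t
    using assms u by (intro AE_PiM_component prob_space_return) (auto simp: AE_return)
  then have "AE x in (\<Pi>\<^sub>M t\<in>(UNIV::nat set). return M u). \<forall>t. x t = u"
    by (simp add: AE_all_countable)
  then have "AE x in (\<Pi>\<^sub>M t\<in>(UNIV::nat set). return M u). x = (\<lambda>_. u)"
    by eventually_elim auto
  then have "(\<Pi>\<^sub>M t\<in>(UNIV::nat set). return M u) =
      return (\<Pi>\<^sub>M t\<in>(UNIV::nat set). return M u) (\<lambda>_. u)"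
    by (rule AE_eq_constD)
  also have "\<dots> = return (\<Pi>\<^sub>M t\<in>(UNIV::nat set). M) (\<lambda>_. u)"
    by (intro return_cong sets_PiM_cong) auto
  finally show ?thesis .
qed

lemma measurable_evaluation:
  assumes "expert_instance P"
  shows "(\<lambda>f. f x) \<in> borel_measurable P"
proof -
  have "(\<lambda>f::'a \<Rightarrow> real. f x) \<in> borel_measurable borel"
    by (intro borel_measurable_continuous_onI continuous_on_product_coordinates)
  then have "(\<lambda>f::'a \<Rightarrow> real. f x) \<in> borel_measurable (restrict_space borel {f. \<forall>x. f x \<in> {0..1}})"
    by (rule measurable_restrict_space1)
  then show ?thesis
    using assms by (simp add: expert_instance_def cong: measurable_cong_sets)
qed

lemma evaluation_in_unit_interval:
  assumes "expert_instance P" "f \<in> space P"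
  shows "f x \<in> {0..1}"
proof -
  have "space P = space (restrict_space borel {f. \<forall>x. f x \<in> {0..1}})"
    using assms by (intro sets_eq_imp_space_eq) (simp add: expert_instance_def)
  then show ?thesis
    using assms(2) by (simp add: space_restrict_space)
qed

lemma integrable_evaluation:
  assumes "expert_instance P"
  shows "integrable P (\<lambda>f. f x)"
proof -
  interpret prob_space P
    using assms by (simp add: expert_instance_def)
  show ?thesis
    using evaluation_in_unit_interval[OF assms, where x = x] measurable_evaluation[OF assms]
    by (intro integrable_const_bound[of _ 1]) auto
qed

lemma mean_in_unit_interval:
  assumes "expert_instance P"
  shows "mean P x \<in> {0..1}"
proof -
  interpret prob_space P
    using assms by (simp add: expert_instance_def)
  show ?thesis
    unfolding mean_def
    using integrable_evaluation[OF assms, of x] evaluation_in_unit_interval[OF assms, where x = x]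
    by (auto intro!: integral_le_const integral_ge_const)
qed

subsection \<open>Lower bound for deterministic payoffs\<close>

text \<open>The deterministic instances: every round has the payoff function \<open>u\<close>, so
  the seed is the only randomness left in a run.\<close>

definition point_mass :: "('a \<Rightarrow> real) \<Rightarrow> ('a \<Rightarrow> real) measure" where
  "point_mass u = return (restrict_space borel {f. \<forall>x. f x \<in> {0..1}}) u"

lemma
  fixes u :: "'a::metric_space \<Rightarrow> real"
  assumes u: "\<And>x. u x \<in> {0..1}" and lip: "\<And>x y. \<bar>u x - u y\<bar> \<le> dist x y"
  shows mean_point_mass: "mean (point_mass u) x = u x"
    and expert_instance_point_mass: "expert_instance (point_mass u)"
proof -
  let ?M = "restrict_space borel {f :: 'a \<Rightarrow> real. \<forall>x. f x \<in> {0..1}}"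
  have sp: "u \<in> space ?M"
    using u by (simp add: space_restrict_space)
  have eval: "(\<lambda>f::'a \<Rightarrow> real. f x) \<in> borel_measurable ?M" for x
    by (intro measurable_restrict_space1 borel_measurable_continuous_onI
        continuous_on_product_coordinates)
  show m: "mean (point_mass u) x = u x" for x
    unfolding mean_def point_mass_def by (rule integral_return[OF sp eval])
  show "expert_instance (point_mass u)"
    unfolding expert_instance_def m
    using prob_space_return[OF sp] lip by (auto simp: point_mass_def)
qed

text \<open>The run space is the product of the seed space with a point mass at the constant
  sequence \<open>u\<close>, so Fubini leaves an integral over the seed. The assumption
  \<open>meas\<close> is what \<open>achieves\<close> provides.\<close>

lemma regret_point_mass:
  fixes u :: "'a::metric_space \<Rightarrow> real"
  assumes u: "\<And>x. u x \<in> {0..1}" and lip: "\<And>x y. \<bar>u x - u y\<bar> \<le> dist x y"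
    and A: "prob_space (seed A)"
    and meas: "\<And>t. (\<lambda>\<omega>. mean (point_mass u) (played A t \<omega>)) \<in>
      borel_measurable (run_space A (point_mass u))"
  shows "regret A (point_mass u) t =
    real t * (SUP x. u x) - (\<integral>s. (\<Sum>i<t. u (played A i (s, \<lambda>_. u))) \<partial>seed A)"
proof -
  let ?M = "restrict_space borel {f :: 'a \<Rightarrow> real. \<forall>x. f x \<in> {0..1}}"
  let ?N = "\<Pi>\<^sub>M t\<in>(UNIV::nat set). ?M"
  \<comment> \<open>A singleton is Borel in the product topology even for uncountable X: it is an
    intersection, possibly uncountable, of closed sets.\<close>
  have "closed ({u} :: ('a \<Rightarrow> real) set)"
  proof -
    have "{u} = (\<Inter>x. {f. f x = u x})"
      by auto
    also have "closed \<dots>"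
      by (intro closed_INT ballI closed_Collect_eq continuous_on_product_coordinates
          continuous_on_const)
    finally show ?thesis .
  qed
  then have "{f. \<forall>x. f x \<in> {0..1}} \<inter> {u} \<in> sets ?M"
    unfolding sets_restrict_space by (intro imageI borel_closed)
  moreover have "{f. \<forall>x. f x \<in> {0..1}} \<inter> {u} = {u}"
    using u by blast
  ultimately have uM: "{u} \<in> sets ?M"
    by metis
  have cN: "(\<lambda>_. u) \<in> space ?N"
    using u by (auto simp: space_PiM space_restrict_space)
  have run: "run_space A (point_mass u) = seed A \<Otimes>\<^sub>M return ?N (\<lambda>_. u)"
    unfolding run_space_def point_mass_def PiM_return_const[OF uM] ..
  interpret S: prob_space "seed A" by fact
  interpret R: prob_space "return ?N (\<lambda>_. u)"
    by (rule prob_space_return[OF cN])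
  interpret Q: pair_prob_space "seed A" "return ?N (\<lambda>_. u)" ..
  define f where "f = (\<lambda>\<omega>. \<Sum>i<t. u (played A i \<omega>))"
  have fm: "f \<in> borel_measurable (seed A \<Otimes>\<^sub>M return ?N (\<lambda>_. u))"
    using meas unfolding f_def run mean_point_mass[OF u lip] by (intro borel_measurable_sum)
  have fb: "norm (f \<omega>) \<le> real t" for \<omega>
  proof -
    have "norm (f \<omega>) \<le> (\<Sum>i<t. norm (u (played A i \<omega>)))"
      unfolding f_def by (rule norm_sum)
    also have "\<dots> \<le> (\<Sum>i<t. 1)"
      using u by (intro sum_mono) auto
    finally show ?thesis by simp
  qed
  have "integrable (seed A \<Otimes>\<^sub>M return ?N (\<lambda>_. u)) f"
    using fb by (intro Q.integrable_const_bound[of _ "real t"] fm) auto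
  then have "(\<integral>\<omega>. f \<omega> \<partial>(seed A \<Otimes>\<^sub>M return ?N (\<lambda>_. u))) =
      (\<integral>s. (\<integral>F. f (s, F) \<partial>return ?N (\<lambda>_. u)) \<partial>seed A)"
    by (rule Q.integral_fst'[symmetric])
  also have "\<dots> = (\<integral>s. f (s, \<lambda>_. u) \<partial>seed A)"
  proof (intro Bochner_Integration.integral_cong refl integral_return[OF cN])
    fix s assume "s \<in> space (seed A)"
    then have "(\<lambda>F. f (s, F)) \<in> borel_measurable (return ?N (\<lambda>_. u))"
      using measurable_compose[OF measurable_Pair1' fm] by blast
    then show "(\<lambda>F. f (s, F)) \<in> borel_measurable ?N"
      by (simp cong: measurable_cong_sets)
  qed
  finally show ?thesis
    unfolding regret_def run mean_point_mass[OF u lip] f_def by simp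
qed

section \<open>Locality and measurability of what an algorithm observes\<close>

lemma wf_before: "wf {(q, p). q \<in> before p}"
proof -
  have "{(q, p). q \<in> before p} = less_than <*lex*> less_than"
    by (auto simp: before_def lex_prod_def)
  then show ?thesis
    by (simp add: wf_lex_prod)
qed

lemma observed_eq:
  "observed A s F p =
     (if snd p = 0 \<or> ask A p (info A s F p) then F (fst p) (point A p (info A s F p)) else 0)"
  by (subst observed.simps) (simp add: info_def Let_def)

lemma
  assumes "full_feedback_algorithm A"
  shows measurable_point: "point A p \<in> measurable (info_space A p) borel"
    and measurable_ask: "ask A p \<in> measurable (info_space A p) (count_space UNIV)"
  using assms unfolding full_feedback_algorithm_def by blast+

text \<open>Well-founded induction along \<open>before\<close>. The value observed is
  \<open>u\<close> at a random point, which is measurable because \<open>u\<close> is Borel and is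
  the same in all rounds.\<close>

lemma measurable_info_const:
  assumes A: "full_feedback_algorithm A" and u: "u \<in> borel_measurable borel"
  shows "(\<lambda>s. info A s (\<lambda>_. u) p) \<in> measurable (seed A) (info_space A p)"
proof -
  have step: "(\<lambda>s. info A s (\<lambda>_. u) p) \<in> measurable (seed A) (info_space A p)"
    if "\<And>q. q \<in> before p \<Longrightarrow> (\<lambda>s. observed A s (\<lambda>_. u) q) \<in> borel_measurable (seed A)" for p
    unfolding info_def info_space_def restrict_def[symmetric]
    using that by (intro measurable_Pair measurable_ident measurable_restrict) auto
  have "(\<lambda>s. observed A s (\<lambda>_. u) p) \<in> borel_measurable (seed A)" for p
    using wf_before
  proof (induction p rule: wf_induct_rule)
    case (less p)
    have i: "(\<lambda>s. info A s (\<lambda>_. u) p) \<in> measurable (seed A) (info_space A p)"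
      using less by (intro step) auto
    have [measurable]: "(\<lambda>s. point A p (info A s (\<lambda>_. u) p)) \<in> measurable (seed A) borel"
      "Measurable.pred (seed A) (\<lambda>s. ask A p (info A s (\<lambda>_. u) p))"
      using measurable_compose[OF i] measurable_point[OF A] measurable_ask[OF A] by blast+
    note u[measurable]
    show ?case
      unfolding observed_eq by measurable
  qed
  then show ?thesis
    by (intro step)
qed

text \<open>The played points are included: these are all the places through which the payoffs can
  influence the run before round \<open>T\<close>.\<close>

definition queries ::
  "('s, 'a) algorithm \<Rightarrow> 's \<Rightarrow> (nat \<Rightarrow> 'a \<Rightarrow> real) \<Rightarrow> nat \<Rightarrow> 'a set" where
  "queries A s F T = {point A p (info A s F p) |p.
     fst p < T \<and> (snd p = 0 \<or> ask A p (info A s F p))}"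

text \<open>There are finitely many rounds, each with finitely many further queries; the inserted
  index 0 accounts for the point played.\<close>

lemma finite_queries:
  assumes A: "full_feedback_algorithm A" and s: "s \<in> space (seed A)"
    and F: "\<And>t x. F t x \<in> {0..1}"
  shows "finite (queries A s F T)"
proof -
  let ?K = "\<lambda>t. insert 0 {k. k \<ge> 1 \<and> ask A (t, k) (info A s F (t, k))}"
  have "finite (?K t)" for t
    using A s F unfolding full_feedback_algorithm_def by auto
  then have "finite (SIGMA t:{..<T}. ?K t)"
    by (intro finite_SigmaI) auto
  moreover have "queries A s F T \<subseteq> (\<lambda>p. point A p (info A s F p)) ` (SIGMA t:{..<T}. ?K t)"
  proof
    fix x assume "x \<in> queries A s F T"
    then obtain p where p: "x = point A p (info A s F p)" "fst p < T"
      "snd p = 0 \<or> ask A p (info A s F p)"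
      unfolding queries_def by blast
    then have "p \<in> (SIGMA t:{..<T}. ?K t)"
      by (cases p) auto
    then show "x \<in> (\<lambda>p. point A p (info A s F p)) ` (SIGMA t:{..<T}. ?K t)"
      using p(1) by blast
  qed
  ultimately show ?thesis
    by (rule finite_surj)
qed

text \<open>By induction along \<open>before\<close>, equal earlier observations lead to the same
  next point, at which \<open>F\<close> and \<open>G\<close> agree. Agreement on the queries of the
  run facing \<open>F\<close> alone is assumed; that the run facing \<open>G\<close> asks the same
  questions is a consequence.\<close>

lemma info_cong_queries:
  assumes eq: "\<And>t x. t < T \<Longrightarrow> x \<in> queries A s F T \<Longrightarrow> F t x = G t x" and "fst p < T"
  shows "info A s F p = info A s G p"
proof -
  have "fst p < T \<Longrightarrow> observed A s F p = observed A s G p" for p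
    using wf_before
  proof (induction p rule: wf_induct_rule)
    case (less p)
    have "info A s F p = info A s G p"
      unfolding info_def using less by (auto simp: before_def intro!: restrict_ext)
    moreover have "F (fst p) (point A p (info A s F p)) = G (fst p) (point A p (info A s F p))"
      if "snd p = 0 \<or> ask A p (info A s F p)"
      using that less.prems by (intro eq) (unfold queries_def, blast+)
    ultimately show ?case
      by (simp add: observed_eq)
  qed
  then show ?thesis
    unfolding info_def using \<open>fst p < T\<close> by (auto simp: before_def intro!: restrict_ext)
qed

lemma played_cong_queries:
  assumes "\<And>t x. t < T \<Longrightarrow> x \<in> queries A s F T \<Longrightarrow> F t x = G t x" and "i < T"
  shows "played A i (s, F) = played A i (s, G)"
proof -
  have "info A s F (i, 0) = info A s G (i, 0)"
    using assms by (intro info_cong_queries) auto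
  then show ?thesis
    by (simp add: played_def)
qed

lemma played_in_queries: "i < T \<Longrightarrow> played A i (s, F) \<in> queries A s F T"
  by (auto simp: played_def queries_def intro!: exI[of _ "(i, 0)"])

text \<open>The event is a countable union over the evaluations \<open>p\<close>.\<close>

lemma sets_queries_hit:
  assumes A: "full_feedback_algorithm A" and u: "u \<in> borel_measurable borel" and W: "open W"
  shows "{s \<in> space (seed A). queries A s (\<lambda>_. u) T \<inter> W \<noteq> {}} \<in> sets (seed A)"
proof -
  have [measurable]: "(\<lambda>s. point A p (info A s (\<lambda>_. u) p)) \<in> measurable (seed A) borel"
    "Measurable.pred (seed A) (\<lambda>s. ask A p (info A s (\<lambda>_. u) p))" for p
    using measurable_compose[OF measurable_info_const[OF A u]]
      measurable_point[OF A] measurable_ask[OF A] by blast+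
  have [measurable]: "W \<in> sets borel"
    using W by simp
  have "{s \<in> space (seed A). queries A s (\<lambda>_. u) T \<inter> W \<noteq> {}} =
    {s \<in> space (seed A). \<exists>p. fst p < T \<and> (snd p = 0 \<or> ask A p (info A s (\<lambda>_. u) p)) \<and>
      point A p (info A s (\<lambda>_. u) p) \<in> W}"
    unfolding queries_def by blast
  also have "\<dots> \<in> sets (seed A)"
    by measurable
  finally show ?thesis .
qed

text \<open>For a fixed seed the finitely many queries all lie outside \<open>W n\<close> once
  \<open>n\<close> is large. Hence the events of hitting \<open>W n\<close> decrease to the empty
  set, and the measure is continuous from above. The bound \<open>m\<close> lets the indices be
  chosen monotonically.\<close>

lemma queries_avoid_late_sets:
  assumes A: "full_feedback_algorithm A" and u: "u \<in> borel_measurable borel"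
    and u01: "\<And>x. u x \<in> {0..1}"
    and W: "decseq W" "\<And>n. open (W n)" "(\<Inter>n. W n) = {}" and e: "e > 0"
  shows "\<exists>n\<ge>m. measure (seed A) {s \<in> space (seed A). queries A s (\<lambda>_. u) T \<inter> W n \<noteq> {}} < e"
proof -
  interpret prob_space "seed A"
    using A by (simp add: full_feedback_algorithm_def)
  let ?E = "\<lambda>n. {s \<in> space (seed A). queries A s (\<lambda>_. u) T \<inter> W n \<noteq> {}}"
  have dec: "W n' \<subseteq> W n" if "n \<le> n'" for n n'
    using W(1) that by (auto simp: decseq_def)
  have "range ?E \<subseteq> sets (seed A)"
    using sets_queries_hit[OF A u W(2)] by blast
  moreover have "decseq ?E"
    unfolding decseq_def using dec by blast
  moreover have "(\<Inter>n. ?E n) = {}"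
  proof -
    have "\<exists>n. s \<notin> ?E n" if s: "s \<in> space (seed A)" for s
    proof -
      let ?Q = "queries A s (\<lambda>_. u) T"
      have fin: "finite ?Q"
        by (rule finite_queries[OF A s u01])
      have "\<forall>y. \<exists>n. y \<notin> W n"
        using W(3) by blast
      then obtain N where N: "\<And>y. y \<notin> W (N y)"
        by metis
      have "y \<notin> W (Max (N ` ?Q))" if "y \<in> ?Q" for y
        using N[of y] dec[of "N y" "Max (N ` ?Q)"] fin that by auto
      then show ?thesis
        by (intro exI[of _ "Max (N ` ?Q)"]) auto
    qed
    then show ?thesis by blast
  qed
  ultimately have "(\<lambda>n. measure (seed A) (?E n)) \<longlonglongrightarrow> 0"
    using finite_Lim_measure_decseq[of ?E] by simp
  then have "\<forall>\<^sub>F n in sequentially. measure (seed A) (?E n) < e"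
    using e by (rule order_tendstoD)
  then obtain N where "\<And>n. n \<ge> N \<Longrightarrow> measure (seed A) (?E n) < e"
    by (auto simp: eventually_sequentially)
  then show ?thesis
    by (intro exI[of _ "max m N"]) auto
qed

section \<open>The adversarial payoff function\<close>

text \<open>Separation by \<open>2 * h\<close> makes the balls of radius \<open>h\<close> disjoint,
  so a point lies in at most one of them and their tail unions shrink to the empty set. The
  restriction \<open>h \<le> 1\<close> keeps the bumps inside the unit interval.\<close>

lemma not_achieves_if_separated:
  fixes x :: "nat \<Rightarrow> 'a::metric_space" and A :: "('s, 'a) algorithm"
  assumes sep: "\<And>i j. i \<noteq> j \<Longrightarrow> 2 * h \<le> dist (x i) (x j)" and h: "0 < h" "h \<le> 1"
    and g: "sublinear g" and A: "full_feedback_algorithm A"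
  shows "\<not> achieves A g"
proof
  assume ach: "achieves A g"
  interpret S: prob_space "seed A"
    using A by (simp add: full_feedback_algorithm_def)
  \<comment> \<open>Heights of the successive bumps. They increase to \<open>h\<close>, and the gap
    \<open>h * (1/2)^n\<close> below \<open>h\<close> is what the algorithm loses per round while it
    sees only the first \<open>n\<close> bumps.\<close>
  define c where "c = (\<lambda>n. h * (1 - (1/2)^n))"
  define W where "W = (\<lambda>n. \<Union>i\<in>{n..}. ball (x i) h)"
  define hit where "hit = (\<lambda>u T m. {s \<in> space (seed A). queries A s (\<lambda>_::nat. u) T \<inter> W m \<noteq> {}})"
  have c_mono: "c n \<le> c (Suc n)" and c_nonneg: "0 \<le> c n" and c_le: "c n \<le> h" for n
    using h(1) by (auto simp: c_def power_le_one intro!: mult_left_mono)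
  have W: "decseq W" "\<And>n. open (W n)" "(\<Inter>n. W n) = {}"
  proof -
    show "decseq W"
      unfolding decseq_def W_def by (auto intro: order_trans)
    show "open (W n)" for n
      unfolding W_def by auto
    have "y \<notin> (\<Inter>n. W n)" for y
    proof
      assume y: "y \<in> (\<Inter>n. W n)"
      then have "y \<in> W 0" by blast
      then obtain i where i: "dist (x i) y < h"
        by (auto simp: W_def)
      have "y \<in> W (Suc i)"
        using y by blast
      then obtain j where j: "j \<ge> Suc i" "dist (x j) y < h"
        by (auto simp: W_def)
      have "dist (x i) (x j) < 2 * h"
        using i j(2) dist_triangle2[of "x i" "x j" y] by simp
      then show False
        using sep[of i j] j(1) by simp
    qed
    then show "(\<Inter>n. W n) = {}" by blast
  qed
  \<comment> \<open>The rate 4^-n is the square of the rate 2^-n at which the gaps shrink, so the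
    forced regret eventually exceeds every constant multiple of \<open>g\<close>.\<close>
  have "\<exists>t\<ge>1. \<bar>g t\<bar> \<le> (1/4)^n * real t" for n
  proof -
    have "\<forall>\<^sub>F t in sequentially. \<bar>g t / real t\<bar> < (1/4)^n"
      using tendstoD[OF g[unfolded sublinear_def], of "(1/4)^n"] by (simp add: dist_real_def)
    then have "\<forall>\<^sub>F t in sequentially. t \<ge> 1 \<and> \<bar>g t / real t\<bar> < (1/4)^n"
      using eventually_ge_at_top by (rule eventually_conj[rotated])
    then obtain t where "t \<ge> 1" "\<bar>g t / real t\<bar> < (1/4)^n"
      by (auto simp: eventually_sequentially)
    then show ?thesis
      by (intro exI[of _ t]) (auto simp: abs_divide field_simps)
  qed
  then obtain T where T: "\<And>n. T n \<ge> 1" "\<And>n. \<bar>g (T n)\<bar> \<le> (1/4)^n * real (T n)"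
    by metis
  have choose: "\<exists>m'\<ge>m. measure (seed A) (hit u (T n) m') < 1/2"
    if lip: "\<forall>y z. \<bar>u y - u z\<bar> \<le> dist y z" and u: "\<forall>y. 0 \<le> u y \<and> u y \<le> c n" for u n m
  proof -
    have "1-lipschitz_on UNIV u"
      using lip by (intro lipschitz_onI) (auto simp: dist_real_def)
    then have "u \<in> borel_measurable borel"
      by (intro borel_measurable_continuous_onI lipschitz_on_continuous_on)
    moreover have "u y \<in> {0..1}" for y
      using u[rule_format, of y] c_le[of n] h(2) by auto
    ultimately show ?thesis
      unfolding hit_def using W by (intro queries_avoid_late_sets[OF A]) auto
  qed
  \<comment> \<open>Invariant: the algorithm facing \<open>u\<close> rarely looks into \<open>W m\<close> before round \<open>T n\<close>, so the next
    bump, placed at \<open>x m\<close>, stays hidden from it.\<close>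
  define hidden where "hidden = (\<lambda>n (u, m). (\<forall>y z. \<bar>u y - u z\<bar> \<le> dist y z) \<and>
    (\<forall>y. 0 \<le> u y \<and> u y \<le> c n) \<and> measure (seed A) (hit u (T n) m) < 1/2)"
  \<comment> \<open>A bump is a cone of slope 1, so the maximum stays 1-Lipschitz. The indices need
    not increase strictly; a later cone may have the same centre.\<close>
  define step where "step = (\<lambda>n (u, m) (u', m'). m \<le> m' \<and>
    u' = (\<lambda>y. max (u y) (c (Suc n) - dist (x m) y)))"
  have "\<exists>st :: nat \<Rightarrow> ('a \<Rightarrow> real) \<times> nat. \<forall>n. hidden n (st n) \<and> step n (st n) (st (Suc n))"
  proof (rule dependent_nat_choice)
    obtain m where "measure (seed A) (hit (\<lambda>_. 0) (T 0) m) < 1/2"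
      using choose[of "\<lambda>_. 0" 0 0] c_nonneg by auto
    then show "\<exists>st. hidden 0 st"
      using c_nonneg by (intro exI[of _ "(\<lambda>_. 0, m)"]) (auto simp: hidden_def)
  next
    fix st :: "('a \<Rightarrow> real) \<times> nat" and n assume st: "hidden n st"
    obtain u m where um: "st = (u, m)" by fastforce
    define u' where "u' = (\<lambda>y. max (u y) (c (Suc n) - dist (x m) y))"
    have lip: "\<forall>y z. \<bar>u' y - u' z\<bar> \<le> dist y z"
    proof (intro allI)
      fix y z
      have "\<bar>u y - u z\<bar> \<le> dist y z"
        using st by (auto simp: hidden_def um)
      moreover have "\<bar>dist (x m) y - dist (x m) z\<bar> \<le> dist y z"
        by (metis abs_dist_diff_le dist_commute)
      ultimately show "\<bar>u' y - u' z\<bar> \<le> dist y z"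
        unfolding u'_def by (auto simp: max_def abs_le_iff)
    qed
    have u': "\<forall>y. 0 \<le> u' y \<and> u' y \<le> c (Suc n)"
    proof (intro allI)
      fix y
      have "0 \<le> u y" "u y \<le> c n"
        using st by (auto simp: hidden_def um)
      then show "0 \<le> u' y \<and> u' y \<le> c (Suc n)"
        using c_mono[of n] by (auto simp: u'_def max_def)
    qed
    obtain m' where "m' \<ge> m" "measure (seed A) (hit u' (T (Suc n)) m') < 1/2"
      using choose[OF lip u', of m] by blast
    then have "hidden (Suc n) (u', m') \<and> step n st (u', m')"
      using lip u' by (auto simp: hidden_def step_def um u'_def)
    then show "\<exists>st'. hidden (Suc n) st' \<and> step n st st'"
      by blast
  qed
  then obtain st :: "nat \<Rightarrow> ('a \<Rightarrow> real) \<times> nat"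
    where st: "\<And>n. hidden n (st n)" "\<And>n. step n (st n) (st (Suc n))"
    by blast
  define u m where "u = (\<lambda>n. fst (st n))" and "m = (\<lambda>n. snd (st n))"
  have lip: "\<bar>u n y - u n z\<bar> \<le> dist y z" and u_nonneg: "0 \<le> u n y" and u_le: "u n y \<le> c n"
    and hit: "measure (seed A) (hit (u n) (T n) (m n)) < 1/2" for n y z
    using st(1)[of n] by (auto simp: hidden_def u_def m_def case_prod_beta)
  have u_Suc: "u (Suc n) y = max (u n y) (c (Suc n) - dist (x (m n)) y)"
    and m_Suc: "m n \<le> m (Suc n)" for n y
    using st(2)[of n] by (auto simp: step_def u_def m_def case_prod_beta)
  have m_mono: "m n \<le> m k" if "n \<le> k" for n k
    using lift_Suc_mono_le[of m, OF m_Suc that] .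
  have u_mono: "u n y \<le> u k y" if "n \<le> k" for n k y
    using lift_Suc_mono_le[of "\<lambda>n. u n y", OF _ that] by (simp add: u_Suc)
  define U where "U = (\<lambda>y. SUP n. u n y)"
  have bdd: "bdd_above (range (\<lambda>n. u n y))" for y
    using u_le c_le by (intro bdd_aboveI[of _ h]) (auto intro: order_trans)
  have u_U: "u n y \<le> U y" for n y
    unfolding U_def by (intro cSUP_upper bdd) auto
  have U_le: "U y \<le> h" for y
    unfolding U_def using u_le c_le by (intro cSUP_least) (auto intro: order_trans)
  have U_nonneg: "0 \<le> U y" for y
    using u_nonneg[of 0 y] u_U[of 0 y] by simp
  have U01: "U y \<in> {0..1}" for y
    using U_nonneg[of y] U_le[of y] h(2) by auto
  have U_lip1: "U y - U z \<le> dist y z" for y z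
  proof -
    have "(SUP n. u n y) \<le> U z + dist y z"
    proof (rule cSUP_least)
      fix n
      show "u n y \<le> U z + dist y z"
        using lip[of n y z] u_U[of n z] by linarith
    qed simp
    then show ?thesis by (simp add: U_def)
  qed
  have U_lip: "\<bar>U y - U z\<bar> \<le> dist y z" for y z
    using U_lip1[of y z] U_lip1[of z y] by (simp add: dist_commute abs_le_iff)
  \<comment> \<open>All bumps added after stage \<open>n\<close> have centres \<open>x k\<close>
    with \<open>k \<ge> m n\<close> and height at most \<open>h\<close>; outside
    \<open>W (m n)\<close> their cones are at most 0 and do not change the maximum.\<close>
  have U_eq: "U y = u n y" if "y \<notin> W (m n)" for n y
  proof -
    have later: "u (n + k) y = u n y" for k
    proof (induction k)
      case (Suc k)
      have "y \<notin> ball (x (m (n + k))) h"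
        using that m_mono[of n "n + k"] by (auto simp: W_def)
      then have "c (Suc (n + k)) - dist (x (m (n + k))) y \<le> 0"
        using c_le[of "Suc (n + k)"] by simp
      then show ?case
        using Suc u_nonneg[of "n + k" y] by (simp add: u_Suc)
    qed simp
    have "u k y \<le> u n y" for k
      using u_mono[of k "n + k" y] later[of k] by simp
    then have "U y \<le> u n y"
      unfolding U_def by (intro cSUP_least) auto
    then show ?thesis
      using u_U[of n y] by simp
  qed
  have bddU: "bdd_above (range U)"
    using U_le by (intro bdd_aboveI[of _ h]) auto
  have supU: "h \<le> (SUP y. U y)"
  proof (rule LIMSEQ_le_const2)
    have "(\<lambda>n. h * (1 - (1/2)^n)) \<longlonglongrightarrow> h * (1 - 0)"
      by (intro tendsto_intros LIMSEQ_power_zero) auto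
    then show "(\<lambda>n. c (Suc n)) \<longlonglongrightarrow> h"
      unfolding c_def by (intro LIMSEQ_Suc) simp
    have "c (Suc n) \<le> (SUP y. U y)" for n
    proof -
      have "c (Suc n) \<le> u (Suc n) (x (m n))"
        by (simp add: u_Suc)
      also have "\<dots> \<le> U (x (m n))"
        by (rule u_U)
      also have "\<dots> \<le> (SUP y. U y)"
        by (intro cSUP_upper bddU) auto
      finally show ?thesis .
    qed
    then show "\<exists>N. \<forall>n\<ge>N. c (Suc n) \<le> (SUP y. U y)"
      by blast
  qed
  note inst = expert_instance_point_mass[OF U01 U_lip]
  obtain C where C: "\<And>t. t \<ge> 1 \<Longrightarrow> regret A (point_mass U) t \<le> C * g t"
    using ach inst unfolding achieves_def by blast
  have meas: "(\<lambda>\<omega>. mean (point_mass U) (played A t \<omega>)) \<in>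
      borel_measurable (run_space A (point_mass U))" for t
    using ach inst unfolding achieves_def by blast
  \<comment> \<open>With probability above 1/2 the run facing \<open>U\<close> coincides, before
    round \<open>T n\<close>, with the run facing \<open>u n\<close>, and then earns at most
    \<open>c n\<close> per round. In the remaining event \<open>E\<close> the bound \<open>h\<close>
    is used.\<close>
  have regret_ge: "real (T n) * (h * (1/2)^n) / 2 \<le> regret A (point_mass U) (T n)" for n
  proof -
    define E where "E = hit (u n) (T n) (m n)"
    have "1-lipschitz_on UNIV (u n)"
      using lip by (intro lipschitz_onI) (auto simp: dist_real_def)
    then have un: "u n \<in> borel_measurable borel"
      by (intro borel_measurable_continuous_onI lipschitz_on_continuous_on)
    have E: "E \<in> sets (seed A)"
      unfolding E_def hit_def by (rule sets_queries_hit[OF A un W(2)])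
    let ?b = "\<lambda>s. real (T n) * h - real (T n) * (h * (1/2)^n) * indicator (space (seed A) - E) s"
    have "(\<integral>s. (\<Sum>i<T n. U (played A i (s, \<lambda>_. U))) \<partial>seed A) \<le> (\<integral>s. ?b s \<partial>seed A)"
    proof (rule integral_mono')
      show "integrable (seed A) ?b"
        using E by (intro Bochner_Integration.integrable_diff integrable_mult_right
            integrable_real_indicator) (auto simp: S.emeasure_eq_measure)
    next
      fix s assume s: "s \<in> space (seed A)"
      \<comment> \<open>\<open>integral_mono'\<close> asks for integrability of the majorant only,
        together with its nonnegativity.\<close>
      have half: "h * (1/2)^n \<le> h"
        using h(1) by (simp add: power_le_one)
      show "0 \<le> ?b s"
        using mult_left_mono[OF half, of "real (T n)"] h(1) by (auto simp: indicator_def)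
      have "U (played A i (s, \<lambda>_. U)) \<le> h - h * (1/2)^n * indicator (space (seed A) - E) s"
        if i: "i < T n" for i
      proof (cases "s \<in> E")
        case False
        then have disj: "queries A s (\<lambda>_. u n) (T n) \<inter> W (m n) = {}"
          using s by (auto simp: E_def hit_def)
        have "played A i (s, \<lambda>_. u n) = played A i (s, \<lambda>_. U)"
          \<comment> \<open>Agreement is checked on the queries of the run facing
            \<open>u n\<close>, the run to which the event \<open>E\<close> refers.\<close>
          using disj U_eq[of _ n] i by (intro played_cong_queries[of "T n"]) (metis disjoint_iff, simp)
        moreover have "played A i (s, \<lambda>_. u n) \<notin> W (m n)"
          using played_in_queries[OF i, of A s "\<lambda>_. u n"] disj by blast
        ultimately have "U (played A i (s, \<lambda>_. U)) \<le> c n"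
          using U_eq u_le by metis
        then show ?thesis
          using False s by (simp add: c_def algebra_simps)
      qed (use U_le in auto)
      then have "(\<Sum>i<T n. U (played A i (s, \<lambda>_. U))) \<le>
          (\<Sum>i<T n. h - h * (1/2)^n * indicator (space (seed A) - E) s)"
        by (intro sum_mono) auto
      then show "(\<Sum>i<T n. U (played A i (s, \<lambda>_. U))) \<le> ?b s"
        by (simp add: algebra_simps)
    qed
    also have "\<dots> = real (T n) * h - real (T n) * (h * (1/2)^n) * (1 - measure (seed A) E)"
      using E by (subst Bochner_Integration.integral_diff)
        (auto simp: S.prob_compl S.emeasure_eq_measure S.prob_space)
    also have "\<dots> \<le> real (T n) * h - real (T n) * (h * (1/2)^n) * (1/2)"
      using hit[of n] h(1) by (intro diff_left_mono mult_left_mono) (auto simp: E_def)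
    finally have "real (T n) * h - real (T n) * (h * (1/2)^n) * (1/2) \<ge>
      (\<integral>s. (\<Sum>i<T n. U (played A i (s, \<lambda>_. U))) \<partial>seed A)" .
    moreover have "real (T n) * h \<le> real (T n) * (SUP y. U y)"
      using supU by (intro mult_left_mono) auto
    ultimately show ?thesis
      unfolding regret_point_mass[OF U01 U_lip S.prob_space_axioms meas] by linarith
  qed
  have "h / 2 \<le> \<bar>C\<bar> * (1/2)^n" for n
  proof -
    have "real (T n) * (h * (1/2)^n) / 2 \<le> C * g (T n)"
      using regret_ge[of n] C[OF T(1)[of n]] by linarith
    also have "\<dots> \<le> \<bar>C\<bar> * \<bar>g (T n)\<bar>"
      by (metis abs_ge_self abs_mult)
    also have "\<dots> \<le> \<bar>C\<bar> * ((1/4)^n * real (T n))"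
      using T(2)[of n] by (intro mult_left_mono) auto
    \<comment> \<open>One factor 2^-n cancels against the regret bound; the other one remains on the
      right and tends to 0, which contradicts \<open>0 < h\<close>.\<close>
    also have "(1/4)^n = (1/2)^n * (1/2::real)^n"
      by (simp flip: power_mult_distrib)
    finally have "(real (T n) * (1/2)^n) * (h / 2) \<le> (real (T n) * (1/2)^n) * (\<bar>C\<bar> * (1/2)^n)"
      by (simp add: algebra_simps)
    then show ?thesis
      using T(1)[of n] by (subst (asm) mult_le_cancel_left_pos) auto
  qed
  moreover have "(\<lambda>n. \<bar>C\<bar> * (1/2)^n) \<longlonglongrightarrow> \<bar>C\<bar> * 0"
    by (intro tendsto_intros LIMSEQ_power_zero) auto
  ultimately have "h / 2 \<le> \<bar>C\<bar> * 0"
    by (intro LIMSEQ_le_const) auto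
  then show False
    using h(1) by simp
qed

subsection \<open>Exploration and commitment\<close>

text \<open>Beyond \<open>N\<close> the terms contribute at most e/2 on average; the finitely many
  earlier ones have a fixed total \<open>S\<close>, which division by \<open>t\<close> makes
  small.\<close>

lemma cesaro_mean_zero:
  fixes a :: "nat \<Rightarrow> real"
  assumes "a \<longlonglongrightarrow> 0"
  shows "(\<lambda>t. (\<Sum>i<t. a i) / real t) \<longlonglongrightarrow> 0"
proof (rule LIMSEQ_I)
  fix e :: real assume "e > 0"
  then obtain N where N: "\<And>i. i \<ge> N \<Longrightarrow> \<bar>a i\<bar> < e / 2"
    using LIMSEQ_D[OF assms, of "e / 2"] by auto
  define S where "S = (\<Sum>i<N. \<bar>a i\<bar>)"
  have "S \<ge> 0"
    unfolding S_def by (intro sum_nonneg) auto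
  have *: "\<bar>\<Sum>i<t. a i\<bar> \<le> S + real t * (e / 2)" for t
  proof -
    have "\<bar>\<Sum>i<t. a i\<bar> \<le> (\<Sum>i<t. \<bar>a i\<bar>)"
      by (rule sum_abs)
    also have "\<dots> \<le> (\<Sum>i<t. (if i < N then \<bar>a i\<bar> else 0) + e / 2)"
      using N \<open>e > 0\<close> by (intro sum_mono) (auto simp: not_less intro: less_imp_le)
    also have "\<dots> = (\<Sum>i\<in>{..<t} \<inter> {i. i < N}. \<bar>a i\<bar>) + real t * (e / 2)"
      by (simp add: sum.distrib sum.inter_restrict)
    also have "\<dots> \<le> S + real t * (e / 2)"
      unfolding S_def by (intro add_right_mono sum_mono2) auto
    finally show ?thesis .
  qed
  obtain M :: nat where M: "real M > 2 * S / e"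
    using reals_Archimedean2 by blast
  have "norm ((\<Sum>i<t. a i) / real t - 0) < e" if t: "t \<ge> Suc M" for t
  proof -
    have "2 * S / e < real t"
      using M t by simp
    then have "S < real t * (e / 2)"
      using \<open>e > 0\<close> by (simp add: field_simps)
    then have "\<bar>\<Sum>i<t. a i\<bar> < real t * e"
      using *[of t] by (simp add: field_simps)
    then show ?thesis
      using t by (simp add: field_simps)
  qed
  then show "\<exists>no. \<forall>t\<ge>no. norm ((\<Sum>i<t. a i) / real t - 0) < e"
    by blast
qed

text \<open>At most sqrt t + 1 squares lie below t.\<close>

lemma squares_density_zero:
  "(\<lambda>t. (\<Sum>i<t. if \<exists>r. i = r\<^sup>2 then 1 else 0 :: real) / real t) \<longlonglongrightarrow> 0"
proof (rule tendsto_sandwich[where f = "\<lambda>_. 0" and h = "\<lambda>t. sqrt (1 / real t) + 1 / real t"])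
  let ?s = "\<lambda>t. (\<Sum>i<t. if \<exists>r. i = r\<^sup>2 then 1 else 0 :: real)"
  have le: "?s t \<le> sqrt (real t) + 1" for t :: nat
  proof -
    have "{i. i < t \<and> (\<exists>r. i = r\<^sup>2)} \<subseteq> (\<lambda>r. r\<^sup>2) ` {..floor_sqrt t}"
      by (auto simp: le_floor_sqrt_iff)
    then have "card {i. i < t \<and> (\<exists>r. i = r\<^sup>2)} \<le> Suc (floor_sqrt t)"
      using surj_card_le[of "{..floor_sqrt t}"] by simp
    moreover have "real (floor_sqrt t) \<le> sqrt (real t)"
      by (rule real_le_rsqrt) (metis floor_sqrt_power2_le of_nat_le_iff of_nat_power)
    moreover have "?s t = real (card {i. i < t \<and> (\<exists>r. i = r\<^sup>2)})"
      by (simp add: sum.If_cases Int_def)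
    ultimately show ?thesis by linarith
  qed
  show "\<forall>\<^sub>F t in sequentially. ?s t / real t \<le> sqrt (1 / real t) + 1 / real t"
  proof (intro always_eventually allI)
    fix t :: nat
    have "?s t / real t \<le> (sqrt (real t) + 1) / real t"
      using le by (intro divide_right_mono) auto
    also have "sqrt (real t) / real t = sqrt (1 / real t)"
      by (simp add: real_sqrt_divide sqrt_divide_self_eq inverse_eq_divide)
    then have "(sqrt (real t) + 1) / real t = sqrt (1 / real t) + 1 / real t"
      by (simp add: add_divide_distrib)
    finally show "?s t / real t \<le> sqrt (1 / real t) + 1 / real t" .
  qed
  have "(\<lambda>t. sqrt (1 / real t) + 1 / real t) \<longlonglongrightarrow> sqrt 0 + 0"
    by (intro tendsto_intros lim_1_over_n)
  then show "(\<lambda>t. sqrt (1 / real t) + 1 / real t) \<longlonglongrightarrow> 0"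
    by simp
  show "\<forall>\<^sub>F t in sequentially. 0 \<le> ?s t / real t"
    by (intro always_eventually allI divide_nonneg_nonneg sum_nonneg) auto
qed simp

text \<open>Enumerate the union of finite nets of radius 1/(k+1). Each net, being finite, is
  exhausted by an initial segment of the enumeration.\<close>

lemma dense_sequence_if_finite_nets:
  assumes "\<And>e. e > 0 \<Longrightarrow> \<exists>K::'a::metric_space set. finite K \<and> (\<forall>x. \<exists>k\<in>K. dist k x < e)"
  shows "\<exists>d :: nat \<Rightarrow> 'a. \<forall>e>0. \<exists>n. \<forall>x. \<exists>j<n. dist (d j) x < e"
proof -
  have "\<forall>k::nat. \<exists>K::'a set. finite K \<and> (\<forall>x. \<exists>y\<in>K. dist y x < 1 / real (Suc k))"
    using assms by simp
  then obtain K :: "nat \<Rightarrow> 'a set" where K: "\<And>k. finite (K k)"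
    "\<And>k x. \<exists>y\<in>K k. dist y x < 1 / real (Suc k)"
    by metis
  define D where "D = (\<Union>k. K k)"
  have D: "countable D"
    unfolding D_def using K(1) by (auto intro: countable_finite)
  have "\<exists>n. \<forall>x. \<exists>j<n. dist (from_nat_into D j) x < e" if e: "e > 0" for e
  proof -
    obtain k where k: "1 / real (Suc k) < e"
      using nat_approx_posE[OF e] by blast
    have "\<exists>j. from_nat_into D j = y" if "y \<in> K k" for y
      using from_nat_into_surj[OF D] that by (auto simp: D_def)
    then obtain i where i: "\<And>y. y \<in> K k \<Longrightarrow> from_nat_into D (i y) = y"
      by metis
    have "\<exists>j<Suc (Max (i ` K k)). dist (from_nat_into D j) x < e" for x
    proof -
      obtain y where y: "y \<in> K k" "dist y x < 1 / real (Suc k)"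
        using K(2) by blast
      then have "dist (from_nat_into D (i y)) x < e"
        using k i by simp
      moreover have "i y < Suc (Max (i ` K k))"
        using K(1) y(1) by (simp add: less_Suc_eq_le)
      ultimately show ?thesis by blast
    qed
    then show ?thesis by blast
  qed
  then show ?thesis by blast
qed

text \<open>Here \<tau> k is the time from which stage k is available, and \<kappa> i is the latest
  stage available at time i. The cap \<open>k \<le> i\<close> keeps the maximum over a finite set,
  since \<tau> is arbitrary; from \<tau> 0 on this set contains 0.\<close>

lemma stage_function:
  fixes \<tau> :: "nat \<Rightarrow> nat"
  shows "\<exists>\<kappa>. filterlim \<kappa> at_top sequentially \<and> (\<forall>i\<ge>\<tau> 0. \<tau> (\<kappa> i) \<le> i)"
proof -
  define \<kappa> where "\<kappa> i = Max {k. k \<le> i \<and> \<tau> k \<le> i}" for i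
  have fin: "finite {k. k \<le> i \<and> \<tau> k \<le> i}" for i
    by simp
  have "\<tau> (\<kappa> i) \<le> i" if "i \<ge> \<tau> 0" for i
    using Max_in[OF fin, of i] that unfolding \<kappa>_def by blast
  moreover have "filterlim \<kappa> at_top sequentially"
    unfolding filterlim_at_top
  proof
    fix Z
    have "Z \<le> \<kappa> i" if "i \<ge> max Z (\<tau> Z)" for i
      unfolding \<kappa>_def using that by (intro Max_ge fin) auto
    then show "\<forall>\<^sub>F i in sequentially. Z \<le> \<kappa> i"
      unfolding eventually_sequentially by blast
  qed
  ultimately show ?thesis by blast
qed

section \<open>Accuracy of sample averages\<close>

text \<open>Deviations in different rounds are independent and centred, so the mixed terms of the
  expanded square vanish; each diagonal term is at most 1.\<close>

lemma product_second_moment_le: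
  assumes P: "expert_instance P" and I: "finite I"
  shows "(\<integral>F. (\<Sum>t\<in>I. F t x - mean P x)\<^sup>2 \<partial>(\<Pi>\<^sub>M t\<in>(UNIV::nat set). P)) \<le> real (card I)"
    and "integrable (\<Pi>\<^sub>M t\<in>(UNIV::nat set). P) (\<lambda>F. (\<Sum>t\<in>I. F t x - mean P x)\<^sup>2)"
proof -
  interpret P: prob_space P
    using P by (simp add: expert_instance_def)
  let ?N = "\<Pi>\<^sub>M t\<in>(UNIV::nat set). P"
  interpret N: prob_space ?N
    by (intro prob_space_PiM P.prob_space_axioms)
  define X where "X t F = F t x - mean P x" for t :: nat and F
  have comp: "(\<lambda>F. F t) \<in> measurable ?N P" for t
    by (rule measurable_component_singleton) simp
  have ev: "(\<lambda>f. f x - mean P x) \<in> borel_measurable P"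
    using measurable_evaluation[OF P] by (intro borel_measurable_diff) auto
  have Xm: "X t \<in> borel_measurable ?N" for t
    unfolding X_def by (rule measurable_compose[OF comp ev])
  have Xb: "\<bar>X t F\<bar> \<le> 1" if "F \<in> space ?N" for t F
  proof -
    have "F t \<in> space P"
      using that by (auto simp: space_PiM)
    then show ?thesis
      using evaluation_in_unit_interval[OF P, of "F t" x] mean_in_unit_interval[OF P, of x]
      by (auto simp: X_def)
  qed
  have Xi: "integrable ?N (X t)" for t
    using Xb Xm by (intro N.integrable_const_bound[of _ 1]) auto
  have XX_le: "X t F * X t' F \<le> 1" "\<bar>X t F * X t' F\<bar> \<le> 1" if "F \<in> space ?N" for t t' F
  proof -
    show "\<bar>X t F * X t' F\<bar> \<le> 1"
      using mult_mono[OF Xb[OF that, of t] Xb[OF that, of t']] by (simp add: abs_mult)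
    then show "X t F * X t' F \<le> 1" by linarith
  qed
  have XXi: "integrable ?N (\<lambda>F. X t F * X t' F)" for t t'
    using XX_le(2) Xm by (intro N.integrable_const_bound[of _ 1]) auto
  have EX: "(\<integral>F. X t F \<partial>?N) = 0" for t
  proof -
    have "(\<integral>F. X t F \<partial>?N) = (\<integral>f. f x - mean P x \<partial>distr ?N P (\<lambda>F. F t))"
      unfolding X_def by (rule integral_distr[symmetric, OF comp ev])
    also have "distr ?N P (\<lambda>F. F t) = P"
      by (intro distr_PiM_component[where M = "\<lambda>_. P"] P.prob_space_axioms) simp
    also have "(\<integral>f. f x - mean P x \<partial>P) = 0"
      using integrable_evaluation[OF P, of x] by (simp add: mean_def P.prob_space)
    finally show ?thesis .
  qed
  \<comment> \<open>The coordinates are independent because their joint law is the product measure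
    itself.\<close>
  have "N.indep_vars (\<lambda>_. P) (\<lambda>t F. F t) UNIV"
  proof (subst N.indep_vars_iff_distr_eq_PiM')
    show "distr ?N (\<Pi>\<^sub>M t\<in>UNIV. P) (\<lambda>F. \<lambda>t\<in>UNIV. F t) = (\<Pi>\<^sub>M t\<in>UNIV. distr ?N P (\<lambda>F. F t))"
      by (subst distr_PiM_component[where M = "\<lambda>_. P"]) (auto intro: P.prob_space_axioms simp: restrict_UNIV distr_id2)
  qed (use comp in auto)
  then have indep: "N.indep_vars (\<lambda>_. borel) X UNIV"
    unfolding X_def by (rule N.indep_vars_compose2) (rule ev)
  have EXX: "(\<integral>F. X t F * X t' F \<partial>?N) = 0" if "t \<noteq> t'" for t t'
  proof -
    have "(\<integral>F. (\<Prod>i\<in>{t, t'}. X i F) \<partial>?N) = (\<Prod>i\<in>{t, t'}. \<integral>F. X i F \<partial>?N)"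
      using Xi by (intro N.indep_vars_lebesgue_integral N.indep_vars_subset[OF indep]) auto
    then show ?thesis
      using that EX by simp
  qed
  have sq: "(\<Sum>t\<in>I. F t x - mean P x)\<^sup>2 = (\<Sum>t\<in>I. \<Sum>t'\<in>I. X t F * X t' F)" for F
    by (simp add: X_def power2_eq_square sum_product)
  show "integrable ?N (\<lambda>F. (\<Sum>t\<in>I. F t x - mean P x)\<^sup>2)"
    unfolding sq using XXi by (intro Bochner_Integration.integrable_sum)
  have "(\<integral>F. (\<Sum>t\<in>I. F t x - mean P x)\<^sup>2 \<partial>?N) = (\<Sum>t\<in>I. \<Sum>t'\<in>I. \<integral>F. X t F * X t' F \<partial>?N)"
    unfolding sq using XXi by (simp add: Bochner_Integration.integral_sum)
  also have "\<dots> \<le> (\<Sum>t\<in>I. \<Sum>t'\<in>I. if t' = t then 1 else 0)"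
  proof (intro sum_mono)
    fix t t'
    have "(\<integral>F. X t F * X t F \<partial>?N) \<le> 1"
      using XX_le(1) by (intro N.integral_le_const XXi) auto
    then show "(\<integral>F. X t F * X t' F \<partial>?N) \<le> (if t' = t then 1 else 0)"
      using EXX by auto
  qed
  also have "\<dots> = real (card I)"
    using I by simp
  finally show "(\<integral>F. (\<Sum>t\<in>I. F t x - mean P x)\<^sup>2 \<partial>?N) \<le> real (card I)" .
qed

text \<open>The variance of an average of \<open>c\<^sup>2\<close> samples is at most 1/c^2. Taking
  the sample size to be a square keeps roots out of the bound. Injectivity of \<open>q\<close> makes
  the samples come from distinct rounds.\<close>

lemma sample_average_error_le:
  fixes q :: "nat \<Rightarrow> nat"
  assumes P: "expert_instance P" and c: "c > 0" and q: "inj q"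
  shows "(\<integral>F. \<bar>(\<Sum>b<c\<^sup>2. F (q b) x) / real (c\<^sup>2) - mean P x\<bar> \<partial>(\<Pi>\<^sub>M t\<in>(UNIV::nat set). P)) \<le> 1 / real c"
proof -
  interpret P: prob_space P
    using P by (simp add: expert_instance_def)
  let ?N = "\<Pi>\<^sub>M t\<in>(UNIV::nat set). P"
  interpret N: prob_space ?N
    by (intro prob_space_PiM P.prob_space_axioms)
  define Z where "Z F = (\<Sum>t\<in>q ` {..<c\<^sup>2}. F t x - mean P x)" for F
  have card: "card (q ` {..<c\<^sup>2}) = c\<^sup>2"
    using inj_on_subset[OF q] by (simp add: card_image)
  have Zi: "integrable ?N (\<lambda>F. (Z F)\<^sup>2)" and ZE: "(\<integral>F. (Z F)\<^sup>2 \<partial>?N) \<le> real (c\<^sup>2)"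
    using product_second_moment_le[OF P, of "q ` {..<c\<^sup>2}" x] unfolding Z_def card by auto
  have Z: "(\<Sum>b<c\<^sup>2. F (q b) x) / real (c\<^sup>2) - mean P x = Z F / real (c\<^sup>2)" for F
  proof -
    have "Z F = (\<Sum>b<c\<^sup>2. F (q b) x) - real (c\<^sup>2) * mean P x"
      unfolding Z_def using inj_on_subset[OF q] by (subst sum.reindex) (auto simp: sum_subtractf)
    then show ?thesis
      using c by (simp add: field_simps)
  qed
  \<comment> \<open>AM-GM: \<open>2 \<bar>y\<bar> \<le> y\<^sup>2 / c + c\<close> replaces the Cauchy-Schwarz inequality.\<close>
  have bound: "\<bar>Z F / real (c\<^sup>2)\<bar> \<le> (Z F)\<^sup>2 / (2 * real c ^ 3) + 1 / (2 * real c)" for F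
  proof -
    have "0 \<le> (\<bar>Z F\<bar> - real c)\<^sup>2"
      by simp
    then have "2 * real c * \<bar>Z F\<bar> \<le> (Z F)\<^sup>2 + (real c)\<^sup>2"
      by (simp add: power2_diff algebra_simps)
    then have "(2 * real c * \<bar>Z F\<bar>) / (2 * real c ^ 3) \<le> ((Z F)\<^sup>2 + (real c)\<^sup>2) / (2 * real c ^ 3)"
      by (intro divide_right_mono) auto
    then show ?thesis
      using c by (simp add: add_divide_distrib power2_eq_square power3_eq_cube abs_mult)
  qed
  have "(\<integral>F. \<bar>Z F / real (c\<^sup>2)\<bar> \<partial>?N) \<le> (\<integral>F. (Z F)\<^sup>2 / (2 * real c ^ 3) + 1 / (2 * real c) \<partial>?N)"
    using Zi bound by (intro integral_mono') auto
  also have "\<dots> = (\<integral>F. (Z F)\<^sup>2 \<partial>?N) / (2 * real c ^ 3) + 1 / (2 * real c)"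
    using Zi by (simp add: N.prob_space)
  also have "\<dots> \<le> real (c\<^sup>2) / (2 * real c ^ 3) + 1 / (2 * real c)"
    using ZE by (intro add_right_mono divide_right_mono) auto
  also have "\<dots> = 1 / real c"
    using c by (simp add: power2_eq_square power3_eq_cube)
  finally show ?thesis
    unfolding Z .
qed

section \<open>The explore-and-commit algorithm\<close>

text \<open>Round \<open>(prod_encode (j, b))\<^sup>2\<close> takes the \<open>b\<close>-th sample of the arm \<open>d j\<close>.\<close>

definition sample_average :: "nat \<Rightarrow> (nat \<times> nat \<Rightarrow> real) \<Rightarrow> nat \<Rightarrow> real" where
  "sample_average M h j = (\<Sum>b<M. h ((prod_encode (j, b))\<^sup>2, 0)) / real M"

text \<open>Ties go to the smallest index, which makes the choice a measurable function of the
  history. For \<open>n = 0\<close> no index qualifies and the value is some fixed number.\<close>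

definition best_arm :: "nat \<Rightarrow> nat \<Rightarrow> (nat \<times> nat \<Rightarrow> real) \<Rightarrow> nat" where
  "best_arm n M h = (LEAST j. j < n \<and> (\<forall>k<n. sample_average M h k \<le> sample_average M h j))"

text \<open>The algorithm is deterministic, and a point mass serves as its seed for any seed type.
  In a square round, \<open>floor_sqrt\<close> recovers the code of the pair (arm, sample
  number).\<close>

definition explore_commit ::
  "(nat \<Rightarrow> 'a) \<Rightarrow> (nat \<Rightarrow> nat) \<Rightarrow> (nat \<Rightarrow> nat) \<Rightarrow> ('s, 'a) algorithm" where
  "explore_commit d n M =
    \<lparr>seed = return (count_space UNIV) undefined,
     point = (\<lambda>p i. if \<exists>r. fst p = r\<^sup>2 then d (fst (prod_decode (floor_sqrt (fst p))))
                    else d (best_arm (n (fst p)) (M (fst p)) (snd i))),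
     ask = (\<lambda>p i. False)\<rparr>"

lemma best_arm_cong:
  assumes "\<And>j b. j < n \<Longrightarrow> b < M \<Longrightarrow>
    h ((prod_encode (j, b))\<^sup>2, 0) = h' ((prod_encode (j, b))\<^sup>2, 0)"
  shows "best_arm n M h = best_arm n M h'"
proof -
  have "sample_average M h j = sample_average M h' j" if "j < n" for j
    using assms that by (simp add: sample_average_def)
  then show ?thesis
    unfolding best_arm_def by (metis (no_types, lifting))
qed

lemma best_arm_is_argmax:
  assumes "n > 0"
  shows "best_arm n M h < n" "k < n \<Longrightarrow> sample_average M h k \<le> sample_average M h (best_arm n M h)"
proof -
  let ?a = "sample_average M h"
  have "Max (?a ` {..<n}) \<in> ?a ` {..<n}"
    using assms by (intro Max_in) auto
  then obtain j where j: "j < n" "?a j = Max (?a ` {..<n})"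
    by auto
  then have "j < n \<and> (\<forall>k<n. ?a k \<le> ?a j)"
    by simp
  then have "best_arm n M h < n \<and> (\<forall>k<n. ?a k \<le> ?a (best_arm n M h))"
    unfolding best_arm_def by (rule LeastI)
  then show "best_arm n M h < n" "k < n \<Longrightarrow> ?a k \<le> ?a (best_arm n M h)"
    by auto
qed

lemma measurable_best_arm:
  assumes "\<And>j b. j < n \<Longrightarrow> b < M \<Longrightarrow> (\<lambda>\<omega>. h \<omega> ((prod_encode (j, b))\<^sup>2, 0)) \<in> borel_measurable N"
  shows "(\<lambda>\<omega>. best_arm n M (h \<omega>)) \<in> measurable N (count_space UNIV)"
proof -
  have a: "(\<lambda>\<omega>. sample_average M (h \<omega>) j) \<in> borel_measurable N" if "j < n" for j
    unfolding sample_average_def using assms that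
    by (intro borel_measurable_divide borel_measurable_sum) auto
  have "Measurable.pred N (\<lambda>\<omega>. j < n \<and> (\<forall>k<n. sample_average M (h \<omega>) k \<le> sample_average M (h \<omega>) j))"
    for j
  proof (cases "j < n")
    case True
    have "Measurable.pred N (\<lambda>\<omega>. sample_average M (h \<omega>) k \<le> sample_average M (h \<omega>) j)"
      if "k < n" for k
      using a[OF True] a[OF that] by measurable
    then have "Measurable.pred N (\<lambda>\<omega>. k < n \<longrightarrow> sample_average M (h \<omega>) k \<le> sample_average M (h \<omega>) j)"
      for k
      by (cases "k < n") simp_all
    then have "Measurable.pred N (\<lambda>\<omega>. \<forall>k<n. sample_average M (h \<omega>) k \<le> sample_average M (h \<omega>) j)"
      by (rule pred_intros_countable(1))
    moreover have "(\<lambda>\<omega>. j < n \<and> (\<forall>k<n. sample_average M (h \<omega>) k \<le> sample_average M (h \<omega>) j)) =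
        (\<lambda>\<omega>. \<forall>k<n. sample_average M (h \<omega>) k \<le> sample_average M (h \<omega>) j)"
      using True by blast
    ultimately show ?thesis
      by (simp only:)
  qed simp
  then show ?thesis
    unfolding best_arm_def by (rule measurable_Least)
qed

text \<open>The assumption \<open>past\<close> places every sample that is used in an earlier round,
  where the restricted history really records it.\<close>

lemma bandit_explore_commit:
  assumes past: "\<And>i j b. j < n i \<Longrightarrow> b < M i \<Longrightarrow> (prod_encode (j, b))\<^sup>2 < i"
  shows "bandit_algorithm (explore_commit d n M :: ('s, 'a::metric_space) algorithm)"
proof -
  let ?A = "explore_commit d n M :: ('s, 'a) algorithm"
  have "point ?A p \<in> measurable (info_space ?A p) borel" for p
  proof (cases "\<exists>r. fst p = r\<^sup>2")
    case True
    then show ?thesis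
      by (simp add: explore_commit_def)
  next
    case False
    have "(\<lambda>i. best_arm (n (fst p)) (M (fst p)) (snd i)) \<in>
        measurable (info_space ?A p) (count_space UNIV)"
    proof (rule measurable_best_arm)
      fix j b assume "j < n (fst p)" "b < M (fst p)"
      then have "((prod_encode (j, b))\<^sup>2, 0) \<in> before p"
        using past by (simp add: before_def)
      then show "(\<lambda>i. snd i ((prod_encode (j, b))\<^sup>2, 0)) \<in> borel_measurable (info_space ?A p)"
        unfolding info_space_def
        by (intro measurable_compose[OF measurable_snd] measurable_component_singleton)
    qed
    then have "(\<lambda>i. d (best_arm (n (fst p)) (M (fst p)) (snd i))) \<in> measurable (info_space ?A p) borel"
      by (rule measurable_compose) simp
    then show ?thesis
      using False by (simp add: explore_commit_def)
  qed
  moreover have "prob_space (seed ?A)"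
    by (simp add: explore_commit_def prob_space_return)
  ultimately show ?thesis
    unfolding bandit_algorithm_def full_feedback_algorithm_def by (simp add: explore_commit_def)
qed

text \<open>The recorded history is replaced by an explicit function of the payoffs; the two agree
  at the sampled rounds, and \<open>best_arm\<close> reads nothing else.\<close>

lemma played_explore_commit:
  assumes past: "\<And>i j b. j < n i \<Longrightarrow> b < M i \<Longrightarrow> (prod_encode (j, b))\<^sup>2 < i"
    and i: "\<nexists>r. i = r\<^sup>2"
  shows "played (explore_commit d n M) i \<omega> = d (best_arm (n i) (M i)
    (\<lambda>p. snd \<omega> (fst p) (d (fst (prod_decode (floor_sqrt (fst p)))))))"
proof -
  let ?A = "explore_commit d n M"
  have obs: "observed ?A (fst \<omega>) (snd \<omega>) (r\<^sup>2, 0) = snd \<omega> (r\<^sup>2) (d (fst (prod_decode r)))" for r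
    by (subst observed_eq) (auto simp: explore_commit_def)
  have "played ?A i \<omega> = d (best_arm (n i) (M i) (snd (info ?A (fst \<omega>) (snd \<omega>) (i, 0))))"
    using i by (simp add: played_def explore_commit_def)
  also have "best_arm (n i) (M i) (snd (info ?A (fst \<omega>) (snd \<omega>) (i, 0))) = best_arm (n i) (M i)
      (\<lambda>p. snd \<omega> (fst p) (d (fst (prod_decode (floor_sqrt (fst p))))))"
    by (rule best_arm_cong) (simp add: info_def before_def past obs)
  finally show ?thesis .
qed

lemma played_explore_commit_square:
  "played (explore_commit d n M) (r\<^sup>2) \<omega> = d (fst (prod_decode r))"
  by (auto simp: played_def explore_commit_def)

lemma measurable_observation:
  assumes "expert_instance P"
  shows "(\<lambda>\<omega>. snd \<omega> t x) \<in> borel_measurable (run_space A P)"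
proof -
  have "(\<lambda>F. F t) \<in> measurable (\<Pi>\<^sub>M t\<in>(UNIV::nat set). P) P"
    by (rule measurable_component_singleton) simp
  then have "(\<lambda>F. F t x) \<in> borel_measurable (\<Pi>\<^sub>M t\<in>(UNIV::nat set). P)"
    by (rule measurable_compose[OF _ measurable_evaluation[OF assms]])
  then show ?thesis
    unfolding run_space_def by (rule measurable_compose[OF measurable_snd])
qed

text \<open>The point played depends on the run only through a natural number, so joint
  measurability of evaluation does not enter.\<close>

lemma measurable_mean_played:
  assumes past: "\<And>i j b. j < n i \<Longrightarrow> b < M i \<Longrightarrow> (prod_encode (j, b))\<^sup>2 < i"
    and P: "expert_instance P"
  shows "(\<lambda>\<omega>. mean P (played (explore_commit d n M) i \<omega>)) \<in>
    borel_measurable (run_space (explore_commit d n M) P)"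
proof (cases "\<exists>r. i = r\<^sup>2")
  case True
  then show ?thesis
    by (auto simp: played_explore_commit_square)
next
  case False
  have "(\<lambda>\<omega>. best_arm (n i) (M i) (\<lambda>p. snd \<omega> (fst p) (d (fst (prod_decode (floor_sqrt (fst p)))))))
      \<in> measurable (run_space (explore_commit d n M) P) (count_space UNIV)"
    by (intro measurable_best_arm measurable_observation P)
  then have "(\<lambda>\<omega>. mean P (d (best_arm (n i) (M i)
        (\<lambda>p. snd \<omega> (fst p) (d (fst (prod_decode (floor_sqrt (fst p)))))))))
      \<in> borel_measurable (run_space (explore_commit d n M) P)"
    by (rule measurable_compose) simp
  then show ?thesis
    using False by (simp add: played_explore_commit[OF past])
qed

lemma bdd_above_mean: "expert_instance P \<Longrightarrow> bdd_above (range (mean P))"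
  using mean_in_unit_interval by (intro bdd_aboveI[of _ 1]) auto

lemma SUP_mean_in_unit_interval:
  assumes "expert_instance P"
  shows "(SUP x. mean P x) \<in> {0..1}"
proof -
  have "0 \<le> mean P undefined"
    using mean_in_unit_interval[OF assms] by simp
  also have "\<dots> \<le> (SUP x. mean P x)"
    by (intro cSUP_upper bdd_above_mean assms) simp
  finally have "0 \<le> (SUP x. mean P x)" .
  moreover have "(SUP x. mean P x) \<le> 1"
    using mean_in_unit_interval[OF assms] by (intro cSUP_least) auto
  ultimately show ?thesis by simp
qed

section \<open>Regret of exploration and commitment\<close>

text \<open>Moving from \<open>x\<close> to a nearby \<open>d j\<close> costs \<open>e\<close>;
  passing from means to averages and back costs one error each for \<open>j\<close> and the chosen
  arm. Bounding both by the sum of all errors gives an expression whose expectation is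
  immediate.\<close>

lemma mean_best_arm_ge:
  assumes P: "expert_instance P" and n: "n > 0"
    and net: "\<And>x. \<exists>j<n. dist (d j) x < e"
  shows "(SUP x. mean P x) - e - 2 * (\<Sum>j<n. \<bar>sample_average M h j - mean P (d j)\<bar>)
    \<le> mean P (d (best_arm n M h))"
proof -
  let ?err = "\<lambda>j. \<bar>sample_average M h j - mean P (d j)\<bar>"
  let ?S = "\<Sum>j<n. ?err j"
  let ?J = "best_arm n M h"
  have err: "?err j \<le> ?S" if "j < n" for j
    using that by (intro member_le_sum) auto
  have "mean P x \<le> mean P (d ?J) + e + 2 * ?S" for x
  proof -
    obtain j where j: "j < n" "dist (d j) x < e"
      using net by blast
    have "\<bar>mean P (d j) - mean P x\<bar> \<le> dist (d j) x"
      using P by (simp add: expert_instance_def)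
    then show ?thesis
      using j(2) err[OF j(1)] err[OF best_arm_is_argmax(1)[OF n, of M h]]
        best_arm_is_argmax(2)[OF n j(1), of M h] by linarith
  qed
  then have "(SUP x. mean P x) \<le> mean P (d ?J) + e + 2 * ?S"
    by (intro cSUP_least) auto
  then show ?thesis by simp
qed

text \<open>The pointwise bound of \<open>mean_best_arm_ge\<close> is integrated: \<open>n i\<close>
  errors, each of expectation at most 1/c and counted twice.\<close>

lemma expected_gap_le:
  fixes d :: "nat \<Rightarrow> 'a::metric_space" and A :: "('s, 'a) algorithm"
  assumes A: "A = explore_commit d n M"
    and past: "\<And>i j b. j < n i \<Longrightarrow> b < M i \<Longrightarrow> (prod_encode (j, b))\<^sup>2 < i"
    and P: "expert_instance P" and i: "\<nexists>r. i = r\<^sup>2" and n: "n i > 0"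
    and net: "\<And>x. \<exists>j<n i. dist (d j) x < e" and c: "c > 0" "M i = c\<^sup>2"
  shows "(SUP x. mean P x) - (\<integral>\<omega>. mean P (played A i \<omega>) \<partial>run_space A P) \<le> e + 2 * real (n i) / real c"
proof -
  interpret P: prob_space P
    using P by (simp add: expert_instance_def)
  let ?N = "\<Pi>\<^sub>M t\<in>(UNIV::nat set). P"
  interpret N: prob_space ?N
    by (intro prob_space_PiM P.prob_space_axioms)
  interpret S: prob_space "seed A"
    by (simp add: A explore_commit_def prob_space_return)
  interpret Q: pair_prob_space "seed A" ?N ..
  define err where "err j F = \<bar>(\<Sum>b<c\<^sup>2. F ((prod_encode (j, b))\<^sup>2) (d j)) / real (c\<^sup>2) - mean P (d j)\<bar>"
    for j and F :: "nat \<Rightarrow> 'a \<Rightarrow> real"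
  have errm: "(\<lambda>\<omega>. err j (snd \<omega>)) \<in> borel_measurable (seed A \<Otimes>\<^sub>M ?N)" for j
    unfolding err_def using measurable_observation[OF P, of _ _ A, unfolded run_space_def]
    by (intro borel_measurable_abs borel_measurable_diff borel_measurable_divide
        borel_measurable_sum) auto
  have errb: "norm (err j F) \<le> 1" if "F \<in> space ?N" for j F
  proof -
    have F: "F t (d j) \<in> {0..1}" for t
      using that by (intro evaluation_in_unit_interval[OF P]) (auto simp: space_PiM)
    have "(\<Sum>b<c\<^sup>2. F ((prod_encode (j, b))\<^sup>2) (d j)) \<le> (\<Sum>b<c\<^sup>2. 1)"
      using F by (intro sum_mono) auto
    then have "(\<Sum>b<c\<^sup>2. F ((prod_encode (j, b))\<^sup>2) (d j)) / real (c\<^sup>2) \<le> 1"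
      using c(1) by (simp add: field_simps)
    moreover have "0 \<le> (\<Sum>b<c\<^sup>2. F ((prod_encode (j, b))\<^sup>2) (d j)) / real (c\<^sup>2)"
      using F by (intro divide_nonneg_nonneg sum_nonneg) auto
    ultimately show ?thesis
      using mean_in_unit_interval[OF P, of "d j"] by (auto simp: err_def abs_le_iff)
  qed
  have erri: "integrable (seed A \<Otimes>\<^sub>M ?N) (\<lambda>\<omega>. err j (snd \<omega>))" for j
    using errb by (intro Q.integrable_const_bound[of _ 1] errm AE_I2) (auto simp: space_pair_measure)
  have errE: "(\<integral>\<omega>. err j (snd \<omega>) \<partial>(seed A \<Otimes>\<^sub>M ?N)) \<le> 1 / real c" for j
  proof -
    have "(\<integral>\<omega>. err j (snd \<omega>) \<partial>(seed A \<Otimes>\<^sub>M ?N)) = (\<integral>s. \<integral>F. err j F \<partial>?N \<partial>seed A)"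
      using Q.integral_fst'[OF erri[of j]] by simp
    also have "\<dots> = (\<integral>F. err j F \<partial>?N)"
      by (simp add: S.prob_space)
    also have "\<dots> \<le> 1 / real c"
      unfolding err_def
      by (rule sample_average_error_le[OF P c(1)]) (auto simp: inj_on_def)
    finally show ?thesis .
  qed
  let ?l = "\<lambda>\<omega>. (SUP x. mean P x) - e - 2 * (\<Sum>j<n i. err j (snd \<omega>))"
  have ge: "?l \<omega> \<le> mean P (played A i \<omega>)" for \<omega>
  proof -
    let ?h = "\<lambda>p. snd \<omega> (fst p) (d (fst (prod_decode (floor_sqrt (fst p)))))"
    have "err j (snd \<omega>) = \<bar>sample_average (M i) ?h j - mean P (d j)\<bar>" for j
      by (simp add: err_def sample_average_def c(2))
    then show ?thesis
      using mean_best_arm_ge[OF P n net, of "M i" ?h] played_explore_commit[OF past i, where d = d and \<omega> = \<omega>]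
      by (simp add: A)
  qed
  have "(SUP x. mean P x) - e - 2 * (real (n i) * (1 / real c)) \<le>
      (SUP x. mean P x) - e - 2 * (\<Sum>j<n i. \<integral>\<omega>. err j (snd \<omega>) \<partial>(seed A \<Otimes>\<^sub>M ?N))"
    using sum_mono[of "{..<n i}", OF errE, of "\<lambda>j. j"] by simp
  also have "\<dots> = (\<integral>\<omega>. ?l \<omega> \<partial>(seed A \<Otimes>\<^sub>M ?N))"
    using erri by (simp add: Bochner_Integration.integral_sum Q.prob_space)
  also have "\<dots> \<le> (\<integral>\<omega>. mean P (played A i \<omega>) \<partial>(seed A \<Otimes>\<^sub>M ?N))"
  proof (rule integral_mono[OF _ _ ge])
    show "integrable (seed A \<Otimes>\<^sub>M ?N) ?l"
      using erri by (intro Bochner_Integration.integrable_diff Q.integrable_const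
          integrable_mult_right Bochner_Integration.integrable_sum)
    show "integrable (seed A \<Otimes>\<^sub>M ?N) (\<lambda>\<omega>. mean P (played A i \<omega>))"
      using measurable_mean_played[OF past P, where d = d and i = i] mean_in_unit_interval[OF P]
      by (intro Q.integrable_const_bound[of _ 1]) (auto simp: A run_space_def)
  qed
  finally show ?thesis
    by (simp add: run_space_def)
qed

lemma bandit_tractable_if_finite_nets:
  assumes nets: "\<And>e. e > 0 \<Longrightarrow> \<exists>K::'a::metric_space set. finite K \<and> (\<forall>x. \<exists>k\<in>K. dist k x < e)"
  shows "\<exists>f. sublinear f \<and> bandit_tractable TYPE('a) TYPE('s) f"
proof -
  obtain d :: "nat \<Rightarrow> 'a" where d: "\<And>e. e > 0 \<Longrightarrow> \<exists>n. \<forall>x. \<exists>j<n. dist (d j) x < e"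
    using dense_sequence_if_finite_nets[OF nets] by blast
  have "\<forall>k. \<exists>n. \<forall>x. \<exists>j<n. dist (d j) x < 1 / real (Suc k)"
    using d by simp
  then obtain N where N: "\<And>k x. \<exists>j<N k. dist (d j) x < 1 / real (Suc k)"
    by metis
  have N_pos: "N k > 0" for k
    using N[of k undefined] by auto
  \<comment> \<open>With this choice 2 N k / c k = 2/(k+1), which together with the net radius
    1/(k+1) gives the gap 3/(k+1) in \<open>r'\<close>.\<close>
  define c where "c k = Suc k * N k" for k
  \<comment> \<open>The first round before which all samples required by stage k have been
    taken.\<close>
  define \<tau> where "\<tau> k = Suc (Max ((\<lambda>p. (prod_encode p)\<^sup>2) ` ({..<N k} \<times> {..<(c k)\<^sup>2})))" for k
  have \<tau>: "(prod_encode (j, b))\<^sup>2 < \<tau> k" if "j < N k" "b < (c k)\<^sup>2" for j b k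
    unfolding \<tau>_def less_Suc_eq_le using that by (intro Max_ge) auto
  obtain \<kappa> where \<kappa>: "filterlim \<kappa> at_top sequentially" "\<And>i. i \<ge> \<tau> 0 \<Longrightarrow> \<tau> (\<kappa> i) \<le> i"
    using stage_function[of \<tau>] by blast
  \<comment> \<open>Before \<tau> 0 no stage is available; the value 0 makes \<open>past\<close>
    vacuous there.\<close>
  define n where "n i = (if \<tau> 0 \<le> i then N (\<kappa> i) else 0)" for i
  define M where "M i = (c (\<kappa> i))\<^sup>2" for i
  have past: "(prod_encode (j, b))\<^sup>2 < i" if "j < n i" "b < M i" for i j b
    using that \<tau>[of j "\<kappa> i" b] \<kappa>(2)[of i] by (auto simp: n_def M_def split: if_splits)
  define A :: "('s, 'a) algorithm" where "A = explore_commit d n M"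
  \<comment> \<open>The value 1 is the trivial bound on the gap of a single round. These bounds do
    not depend on the instance, so their partial sums can serve as the rate, with constant
    1.\<close>
  define r' where "r' i = (if i < \<tau> 0 then 1 else 3 / real (Suc (\<kappa> i)))" for i
  define r where "r i = (if \<exists>q. i = q\<^sup>2 then 1 else 0) + r' i" for i
  have A: "bandit_algorithm A"
    unfolding A_def using past by (rule bandit_explore_commit)
  have "sublinear (\<lambda>t. \<Sum>i<t. r i)"
  proof -
    have "(\<lambda>k. 3 / real (Suc k)) \<longlonglongrightarrow> 0"
      by (rule LIMSEQ_Suc[OF lim_const_over_n])
    then have "(\<lambda>i. 3 / real (Suc (\<kappa> i))) \<longlonglongrightarrow> 0"
      using \<kappa>(1) by (rule filterlim_compose)
    moreover have "\<forall>\<^sub>F i in sequentially. 3 / real (Suc (\<kappa> i)) = r' i"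
      using eventually_ge_at_top[of "\<tau> 0"] by eventually_elim (simp add: r'_def)
    ultimately have "r' \<longlonglongrightarrow> 0"
      by (rule Lim_transform_eventually)
    from tendsto_add[OF squares_density_zero cesaro_mean_zero[OF this]]
    show ?thesis
      by (simp add: sublinear_def r_def sum.distrib add_divide_distrib)
  qed
  moreover have "achieves A (\<lambda>t. \<Sum>i<t. r i)"
    unfolding achieves_def
  proof (intro allI impI conjI)
    fix P :: "('a \<Rightarrow> real) measure" assume P: "expert_instance P"
    show meas: "(\<lambda>\<omega>. mean P (played A i \<omega>)) \<in> borel_measurable (run_space A P)" for i
      unfolding A_def using past P by (rule measurable_mean_played)
    interpret P: prob_space P
      using P by (simp add: expert_instance_def)
    interpret R: prob_space "run_space A P"
      unfolding run_space_def using A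
      by (intro prob_space_pair prob_space_PiM P.prob_space_axioms)
        (simp add: bandit_algorithm_def full_feedback_algorithm_def)
    have int: "integrable (run_space A P) (\<lambda>\<omega>. mean P (played A i \<omega>))" for i
      using meas mean_in_unit_interval[OF P] by (intro R.integrable_const_bound[of _ 1]) auto
    have gap: "(SUP x. mean P x) - (\<integral>\<omega>. mean P (played A i \<omega>) \<partial>run_space A P) \<le> r i" for i
    proof (cases "(\<exists>q. i = q\<^sup>2) \<or> i < \<tau> 0")
      case True
      then have "1 \<le> r i"
        by (auto simp: r_def r'_def)
      moreover have "0 \<le> (\<integral>\<omega>. mean P (played A i \<omega>) \<partial>run_space A P)"
        using mean_in_unit_interval[OF P] by (intro Bochner_Integration.integral_nonneg) auto
      ultimately show ?thesis
        using SUP_mean_in_unit_interval[OF P] by simp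
    next
      case False
      then have n: "n i = N (\<kappa> i)" and sq: "\<nexists>q. i = q\<^sup>2"
        by (auto simp: n_def)
      have "(SUP x. mean P x) - (\<integral>\<omega>. mean P (played A i \<omega>) \<partial>run_space A P)
          \<le> 1 / real (Suc (\<kappa> i)) + 2 * real (n i) / real (c (\<kappa> i))"
        by (rule expected_gap_le[OF A_def past P sq]) (use N N_pos n in \<open>auto simp: M_def c_def\<close>)
      also have "\<dots> = 3 / real (Suc (\<kappa> i))"
        using N_pos[of "\<kappa> i"] unfolding n c_def of_nat_mult by (simp add: divide_simps)
      also have "\<dots> = r i"
        using False by (auto simp: r_def r'_def)
      finally show ?thesis .
    qed
    have "regret A P t \<le> 1 * (\<Sum>i<t. r i)" for t
    proof -
      have "regret A P t = (\<Sum>i<t. (SUP x. mean P x) - (\<integral>\<omega>. mean P (played A i \<omega>) \<partial>run_space A P))"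
        unfolding regret_def using int by (simp add: Bochner_Integration.integral_sum sum_subtractf)
      also have "\<dots> \<le> (\<Sum>i<t. r i)"
        using gap by (intro sum_mono)
      finally show ?thesis by simp
    qed
    then show "\<exists>C. \<forall>t\<ge>1. regret A P t \<le> C * (\<Sum>i<t. r i)"
      by blast
  qed
  ultimately show ?thesis
    unfolding bandit_tractable_def using A by blast
qed

section \<open>The dichotomy\<close>

lemma finite_nets_if_full_feedback_tractable:
  assumes diam: "\<forall>x y :: 'a::metric_space. dist x y \<le> 1"
    and g: "sublinear g" "full_feedback_tractable TYPE('a) TYPE('s) g" and e: "e > 0"
  shows "\<exists>K::'a set. finite K \<and> (\<forall>x. \<exists>k\<in>K. dist k x < e)"
proof (rule ccontr)
  assume "\<nexists>K::'a set. finite K \<and> (\<forall>x. \<exists>k\<in>K. dist k x < e)"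
  then obtain x :: "nat \<Rightarrow> 'a" where x: "\<And>i j. i \<noteq> j \<Longrightarrow> e \<le> dist (x i) (x j)"
    using separated_sequence_if_no_finite_net by blast
  \<comment> \<open>The diameter bound enters here: it gives \<open>e \<le> 1\<close>, so bumps of
    height up to e/2 are admissible payoffs.\<close>
  have "e \<le> dist (x 0) (x 1)"
    by (rule x) simp
  then have "e \<le> 1"
    using diam order_trans by blast
  obtain A :: "('s, 'a) algorithm" where "full_feedback_algorithm A" "achieves A g"
    using g(2) unfolding full_feedback_tractable_def by blast
  moreover have "\<not> achieves A g"
    using x e \<open>e \<le> 1\<close> g(1) calculation(1)
    by (intro not_achieves_if_separated[of "e / 2" x]) auto
  ultimately show False by blast
qed

theorem theorem6p2:
  assumes "\<forall>x y :: 'a::metric_space. dist x y \<le> 1"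
  shows "((\<exists>f. sublinear f \<and> bandit_tractable TYPE('a) TYPE('s) f) \<longleftrightarrow>
            \<not> (\<forall>g. sublinear g \<longrightarrow> \<not> full_feedback_tractable TYPE('a) TYPE('s) g)) \<and>
         ((\<exists>f. sublinear f \<and> bandit_tractable TYPE('a) TYPE('s) f) \<longleftrightarrow>
            compact_completion TYPE('a))"
proof -
  let ?bandit = "\<exists>f. sublinear f \<and> bandit_tractable TYPE('a) TYPE('s) f"
  let ?full = "\<exists>g. sublinear g \<and> full_feedback_tractable TYPE('a) TYPE('s) g"
  \<comment> \<open>A cycle of three implications yields both equivalences.\<close>
  have "?bandit \<Longrightarrow> ?full"
    unfolding bandit_tractable_def full_feedback_tractable_def bandit_algorithm_def by blast
  moreover have "?full \<Longrightarrow> compact_completion TYPE('a)"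
    unfolding compact_completion_iff_finite_nets
    using finite_nets_if_full_feedback_tractable[OF assms] by blast
  moreover have "compact_completion TYPE('a) \<Longrightarrow> ?bandit"
    unfolding compact_completion_iff_finite_nets
    using bandit_tractable_if_finite_nets by blast
  ultimately show ?thesis by blast
qed

end
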